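(* Let $\mathcal{F}=\{\mathbb{R}^d;f_1,\dots,f_N\}$ and $\mathcal{G}=\{\mathbb{R}^d;g_1,\dots,g_N\}$ be IFSs with $\|f_i(x)-f_i(x')\|=c\|x-x'\|$ and $\|g_i(y)-g_i(y')\|=c\|y-y'\|$ for all $i$ and all $x,x',y,y'\in\mathbb{R}^d$, where $0<c<1$ and $N\ge2$. Let $(p_1,\dots,p_N)$ and $(q_1,\dots,q_N)$ be probability vectors (all entries positive) for $\mathcal{F}$ and $\mathcal{G}$ respectively, and define the weighted IFS $\mathcal{F}\times\mathcal{G}=\{\mathbb{R}^d\times\mathbb{R}^d;\Psi_{ij};p_iq_j:1\le i,j\le N\}$ with $\Psi_{ij}(x,y)=(f_i(x),g_j(y))$. Let $\mu_\mathcal{F},\mu_\mathcal{G},\mu_{\mathcal{F}\times\mathcal{G}}$ be the corresponding invariant measures. If $\mathcal{F}$ and $\mathcal{G}$ satisfy the open set condition, then for every $0<r<\infty$, $$D_r>\max\{D_r^*,D_r'\},$$ where $D_r^*,D_r',D_r$ are the quantization dimensions of order $r$ of $\mu_\mathcal{F},\mu_\mathcal{G},\mu_{\mathcal{F}\times\mathcal{G}}$ respectively.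
   Context: $\mathbb{R}^d\times\mathbb{R}^d=\mathbb{R}^{2d}$ with the Euclidean norm. OSC: there is a nonempty open $U$ with $f_i(U)\subset U$ for all $i$ and $f_i(U)\cap f_j(U)=\emptyset$ for $i\ne j$. Invariant measure of a weighted IFS $\{\theta_k;w_k\}$: unique Borel probability $\nu$ with $\nu=\sum_kw_k\,\nu\circ\theta_k^{-1}$. For a Borel probability $\nu$ on $\mathbb{R}^m$: $V_{n,r}(\nu)=\inf\{\int\operatorname{dist}(z,B)^rd\nu(z):\operatorname{card}B\le n\}$, $e_{n,r}=V_{n,r}^{1/r}$, and the quantization dimension is $D_r(\nu)=\lim_{n\to\infty}\frac{\log n}{-\log e_{n,r}(\nu)}$ (for self-similar measures under OSC this limit exists and is the unique solution $D$ of $\sum_k(w_kc_k^r)^{D/(r+D)}=1$, $c_k$ the similarity ratios). *)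

theory Defs
  imports "HOL-Analysis.Analysis" "HOL-Probability.Probability"
begin

definition osc :: "nat \<Rightarrow> (nat \<Rightarrow> 'a::topological_space \<Rightarrow> 'a) \<Rightarrow> bool" where
  "osc N f \<longleftrightarrow> (\<exists>U. open U \<and> U \<noteq> {} \<and> (\<forall>i<N. f i ` U \<subseteq> U) \<and>
      (\<forall>i<N. \<forall>j<N. i \<noteq> j \<longrightarrow> f i ` U \<inter> f j ` U = {}))"

definition invariant_measure ::
  "'i set \<Rightarrow> ('i \<Rightarrow> 'a::topological_space \<Rightarrow> 'a) \<Rightarrow> ('i \<Rightarrow> real) \<Rightarrow> 'a measure \<Rightarrow> bool" where
  "invariant_measure I \<theta> w \<nu> \<longleftrightarrow>
     sets \<nu> = sets borel \<and> prob_space \<nu> \<and>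
     (\<forall>A\<in>sets borel. emeasure \<nu> A = (\<Sum>k\<in>I. ennreal (w k) * emeasure \<nu> (\<theta> k -` A)))"

definition quant_V :: "'a::metric_space measure \<Rightarrow> real \<Rightarrow> nat \<Rightarrow> real" where
  "quant_V \<nu> r n = enn2real (INF B \<in> {B. finite B \<and> B \<noteq> {} \<and> card B \<le> n}.
      \<integral>\<^sup>+ z. ennreal (infdist z B powr r) \<partial>\<nu>)"

definition quant_e :: "'a::metric_space measure \<Rightarrow> real \<Rightarrow> nat \<Rightarrow> real" where
  "quant_e \<nu> r n = quant_V \<nu> r n powr (1 / r)"

definition quantization_dimension :: "'a::metric_space measure \<Rightarrow> real \<Rightarrow> real" where
  "quantization_dimension \<nu> r = lim (\<lambda>n. ln (real n) / (- ln (quant_e \<nu> r n)))"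

end

(*
Put u_i = w_i c^r, let s in (0,1) solve sum_i u_i^s = 1, and t_i = u_i^s. The n-th quantization error
to the power r decays like n^(-(1-s)/s), so the quantization dimension is r s / (1 - s).

Upper bound: gluing the images of near-optimal sets at the scales eps / u_i gives a set at the scale
eps, with at most a eps^(-s) points and error at most b eps^(1-s); both bounds reproduce themselves
because sum_i u_i^s = 1.

Lower bound: by Chebyshev's inequality, words of a fixed length L whose weight is about exp(-L H),
H being the entropy of t, carry at least half of the mass of t. All cylinders of level L have the
same size c^L because the ratios agree, so by the open set condition a point is close to a bounded
number of them only, and exp(L H) points up to a constant miss most of the typical cylinders.

For the product system the sum at exponent s factors as
(sum_i (p_i c^r)^s) (sum_j q_j^s), and the last factor exceeds 1 when s < 1.
*)
theory Submission
  imports Defs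
begin

section \<open>Typical words\<close>

definition words :: "'i set \<Rightarrow> nat \<Rightarrow> 'i list set" where
  "words I L = {xs. set xs \<subseteq> I \<and> length xs = L}"

lemma words_0 [simp]: "words I 0 = {[]}"
  by (auto simp: words_def)

lemma finite_words: "finite I \<Longrightarrow> finite (words I L)"
  unfolding words_def by (rule finite_lists_length_eq)

lemma sum_words_Suc:
  fixes F :: "'i list \<Rightarrow> 'c::comm_monoid_add"
  shows "(\<Sum>\<sigma>\<in>words I (Suc L). F \<sigma>) = (\<Sum>k\<in>I. \<Sum>\<sigma>\<in>words I L. F (k # \<sigma>))"
proof -
  have "words I (Suc L) = (\<lambda>(k, \<sigma>). k # \<sigma>) ` (I \<times> words I L)"
    by (auto simp: words_def length_Suc_conv image_iff)
  moreover have "inj_on (\<lambda>(k, \<sigma>). k # \<sigma>) (I \<times> words I L)"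
    by (auto simp: inj_on_def)
  ultimately have "(\<Sum>\<sigma>\<in>words I (Suc L). F \<sigma>) = (\<Sum>(k, \<sigma>)\<in>I \<times> words I L. F (k # \<sigma>))"
    by (simp add: sum.reindex comp_def case_prod_unfold)
  also have "\<dots> = (\<Sum>k\<in>I. \<Sum>\<sigma>\<in>words I L. F (k # \<sigma>))"
    by (rule sum.cartesian_product[symmetric])
  finally show ?thesis .
qed

section \<open>Weights of words: moments of sums over independent letters\<close>

abbreviation word_weight :: "('i \<Rightarrow> real) \<Rightarrow> 'i list \<Rightarrow> real" where
  "word_weight t \<sigma> \<equiv> prod_list (map t \<sigma>)"

lemma word_weight_pos:
  assumes "\<And>k. k \<in> I \<Longrightarrow> 0 < t k" "\<sigma> \<in> words I L"
  shows "0 < word_weight t \<sigma>"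
proof -
  have "set \<sigma> \<subseteq> I" using assms(2) by (simp add: words_def)
  then show ?thesis by (induction \<sigma>) (use assms(1) in auto)
qed

lemma ln_word_weight:
  assumes "\<And>k. k \<in> I \<Longrightarrow> 0 < t k" "\<sigma> \<in> words I L"
  shows "ln (word_weight t \<sigma>) = sum_list (map (\<lambda>k. ln (t k)) \<sigma>)"
proof -
  have "set \<sigma> \<subseteq> I" using assms(2) by (simp add: words_def)
  then have "word_weight t \<sigma> > 0 \<and> ln (word_weight t \<sigma>) = sum_list (map (\<lambda>k. ln (t k)) \<sigma>)"
    by (induction \<sigma>) (use assms(1) in \<open>auto simp: ln_mult_pos\<close>)
  then show ?thesis ..
qed

lemma sum_word_weight:
  assumes "(\<Sum>k\<in>I. t k) = 1"
  shows "(\<Sum>\<sigma>\<in>words I L. word_weight t \<sigma>) = 1"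
  by (induction L) (simp_all add: sum_words_Suc sum_distrib_left[symmetric] assms)

text \<open>Weights multiply along a word, so its letters behave like independent draws from
  \<open>t\<close>, and sums of centred terms stay centred. The recursion splits off the first
  letter.\<close>

lemma word_sum_mean:
  fixes Y :: "'i \<Rightarrow> real"
  assumes "(\<Sum>k\<in>I. t k) = 1" "(\<Sum>k\<in>I. t k * Y k) = 0"
  shows "(\<Sum>\<sigma>\<in>words I L. word_weight t \<sigma> * sum_list (map Y \<sigma>)) = 0"
proof (induction L)
  case (Suc L)
  have "(\<Sum>\<sigma>\<in>words I (Suc L). word_weight t \<sigma> * sum_list (map Y \<sigma>))
      = (\<Sum>k\<in>I. t k * Y k * (\<Sum>\<sigma>\<in>words I L. word_weight t \<sigma>)
            + t k * (\<Sum>\<sigma>\<in>words I L. word_weight t \<sigma> * sum_list (map Y \<sigma>)))"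
    by (simp add: sum_words_Suc sum_distrib_left sum.distrib[symmetric] algebra_simps)
  also have "\<dots> = 0"
    using assms by (simp add: Suc sum_word_weight)
  finally show ?case .
qed simp

text \<open>Variances of independent centred terms add: when the square is expanded after the first
  letter, the mixed product vanishes by \<open>word_sum_mean\<close>.\<close>

lemma word_sum_variance:
  fixes Y :: "'i \<Rightarrow> real"
  assumes "(\<Sum>k\<in>I. t k) = 1" "(\<Sum>k\<in>I. t k * Y k) = 0"
  shows "(\<Sum>\<sigma>\<in>words I L. word_weight t \<sigma> * (sum_list (map Y \<sigma>))\<^sup>2)
       = real L * (\<Sum>k\<in>I. t k * (Y k)\<^sup>2)"
proof (induction L)
  case (Suc L)
  have "(\<Sum>\<sigma>\<in>words I (Suc L). word_weight t \<sigma> * (sum_list (map Y \<sigma>))\<^sup>2)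
      = (\<Sum>k\<in>I. t k * (Y k)\<^sup>2 * (\<Sum>\<sigma>\<in>words I L. word_weight t \<sigma>)
            + 2 * t k * Y k * (\<Sum>\<sigma>\<in>words I L. word_weight t \<sigma> * sum_list (map Y \<sigma>))
            + t k * (\<Sum>\<sigma>\<in>words I L. word_weight t \<sigma> * (sum_list (map Y \<sigma>))\<^sup>2))"
    by (simp add: sum_words_Suc sum_distrib_left sum.distrib[symmetric] algebra_simps power2_eq_square)
  also have "\<dots> = (\<Sum>k\<in>I. t k * (Y k)\<^sup>2) + (\<Sum>k\<in>I. t k) * (real L * (\<Sum>k\<in>I. t k * (Y k)\<^sup>2))"
    by (simp only: Suc sum_word_weight[OF assms(1)] word_sum_mean[OF assms] sum.distrib
        sum_distrib_right) simp
  also have "\<dots> = real (Suc L) * (\<Sum>k\<in>I. t k * (Y k)\<^sup>2)"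
    by (simp add: assms algebra_simps)
  finally show ?case .
qed simp

text \<open>Chebyshev's inequality for the sum of \<open>ln (t k)\<close> along a word. The typical
  words carry at least half of the mass and each weighs at most
  \<open>exp (- L * (H - \<eta>))\<close>, which forces their number to be large. The lower bound on
  their weight is kept for the error estimate.\<close>

lemma typical_words:
  assumes fin: "finite I" and pos: "\<And>k. k \<in> I \<Longrightarrow> 0 < t k" and one: "(\<Sum>k\<in>I. t k) = 1"
    and \<eta>: "0 < \<eta>"
  defines "H \<equiv> - (\<Sum>k\<in>I. t k * ln (t k))"
  shows "\<exists>L0. \<forall>L\<ge>L0. \<exists>T\<subseteq>words I L. exp (real L * (H - \<eta>)) / 2 \<le> real (card T) \<and>
           (\<forall>\<sigma>\<in>T. exp (- (real L * (H + \<eta>))) \<le> word_weight t \<sigma>)"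
proof -
  \<comment> \<open>Centring: the mean of \<open>ln (t k)\<close> under \<open>t\<close> is
    \<open>- H\<close>, so \<open>Y\<close> has mean 0 and \<open>v\<close> is its variance.\<close>
  define Y where "Y k = ln (t k) + H" for k
  define v where "v = (\<Sum>k\<in>I. t k * (Y k)\<^sup>2)"
  have Y0: "(\<Sum>k\<in>I. t k * Y k) = 0"
    using one by (simp add: Y_def distrib_left sum.distrib sum_distrib_right[symmetric] del: minus_mult_right)
      (simp add: H_def)
  have v0: "0 \<le> v"
    unfolding v_def using pos by (intro sum_nonneg mult_nonneg_nonneg) (auto intro: less_imp_le)
  have main: "\<exists>T\<subseteq>words I L. exp (real L * (H - \<eta>)) / 2 \<le> real (card T) \<and>
           (\<forall>\<sigma>\<in>T. exp (- (real L * (H + \<eta>))) \<le> word_weight t \<sigma>)"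
    \<comment> \<open>This size of \<open>L\<close> makes the Chebyshev bound
      \<open>v / (\<eta>\<^sup>2 * L)\<close> on the mass of the atypical words at most 1/2.\<close>
    if L: "2 * v / \<eta>\<^sup>2 \<le> real L" "1 \<le> L" for L
  proof -
    define T where "T = {\<sigma>\<in>words I L. \<bar>sum_list (map Y \<sigma>)\<bar> \<le> \<eta> * real L}"
    have sub: "T \<subseteq> words I L" by (auto simp: T_def)
    have finW: "finite (words I L)" by (rule finite_words[OF fin])
    have SY: "sum_list (map Y \<sigma>) = ln (word_weight t \<sigma>) + real L * H" if "\<sigma> \<in> words I L" for \<sigma>
    proof -
      have "sum_list (map Y \<sigma>) = sum_list (map (\<lambda>k. ln (t k)) \<sigma>) + real (length \<sigma>) * H"
        by (induction \<sigma>) (auto simp: Y_def algebra_simps)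
      with that show ?thesis by (simp add: ln_word_weight[OF pos that] words_def)
    qed
    have wp: "0 < word_weight t \<sigma>" if "\<sigma> \<in> words I L" for \<sigma>
      by (rule word_weight_pos[OF pos that])
    have "(\<Sum>\<sigma>\<in>words I L - T. word_weight t \<sigma>) * (\<eta> * real L)\<^sup>2
        = (\<Sum>\<sigma>\<in>words I L - T. word_weight t \<sigma> * (\<eta> * real L)\<^sup>2)"
      by (rule sum_distrib_right)
    also have "\<dots> \<le> (\<Sum>\<sigma>\<in>words I L - T. word_weight t \<sigma> * (sum_list (map Y \<sigma>))\<^sup>2)"
    proof (rule sum_mono)
      fix \<sigma> assume s: "\<sigma> \<in> words I L - T"
      then have "\<eta> * real L \<le> \<bar>sum_list (map Y \<sigma>)\<bar>" by (auto simp: T_def)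
      then have "(\<eta> * real L)\<^sup>2 \<le> (sum_list (map Y \<sigma>))\<^sup>2"
        using \<eta> by (metis abs_ge_zero abs_le_square_iff abs_of_nonneg less_imp_le mult_nonneg_nonneg of_nat_0_le_iff)
      then show "word_weight t \<sigma> * (\<eta> * real L)\<^sup>2 \<le> word_weight t \<sigma> * (sum_list (map Y \<sigma>))\<^sup>2"
        using wp s by (intro mult_left_mono) (auto intro: less_imp_le)
    qed
    also have "\<dots> \<le> (\<Sum>\<sigma>\<in>words I L. word_weight t \<sigma> * (sum_list (map Y \<sigma>))\<^sup>2)"
      using wp finW by (intro sum_mono2) (auto intro!: mult_nonneg_nonneg intro: less_imp_le)
    also have "\<dots> = real L * v"
      unfolding v_def by (rule word_sum_variance[OF one Y0])
    also have "\<dots> \<le> (\<eta> * real L)\<^sup>2 / 2"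
    proof -
      have "2 * v \<le> real L * \<eta>\<^sup>2" using L(1) \<eta> by (simp add: field_simps)
      then have "real L * (2 * v) \<le> real L * (real L * \<eta>\<^sup>2)" by (rule mult_left_mono) simp
      then show ?thesis by (simp add: power_mult_distrib power2_eq_square mult_ac)
    qed
    finally have "(\<Sum>\<sigma>\<in>words I L - T. word_weight t \<sigma>) * (\<eta> * real L)\<^sup>2 \<le> (1/2) * (\<eta> * real L)\<^sup>2"
      by simp
    moreover have "0 < (\<eta> * real L)\<^sup>2" using \<eta> L by simp
    ultimately have "(\<Sum>\<sigma>\<in>words I L - T. word_weight t \<sigma>) \<le> 1/2"
      by (simp only: mult_le_cancel_right_pos)
    moreover have "(\<Sum>\<sigma>\<in>words I L - T. word_weight t \<sigma>) = 1 - (\<Sum>\<sigma>\<in>T. word_weight t \<sigma>)"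
      using sum_diff[OF finW sub, of "word_weight t"] by (simp add: sum_word_weight[OF one])
    ultimately have half: "1/2 \<le> (\<Sum>\<sigma>\<in>T. word_weight t \<sigma>)" by simp
    have ub: "word_weight t \<sigma> \<le> exp (- (real L * (H - \<eta>)))"
      and lb: "exp (- (real L * (H + \<eta>))) \<le> word_weight t \<sigma>" if "\<sigma> \<in> T" for \<sigma>
    proof -
      have "\<sigma> \<in> words I L" and "\<bar>ln (word_weight t \<sigma>) + real L * H\<bar> \<le> \<eta> * real L"
        using that SY by (auto simp: T_def)
      then have "ln (word_weight t \<sigma>) \<le> - (real L * (H - \<eta>))" "- (real L * (H + \<eta>)) \<le> ln (word_weight t \<sigma>)"
        by (auto simp: algebra_simps abs_le_iff)
      then show "word_weight t \<sigma> \<le> exp (- (real L * (H - \<eta>)))"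
          "exp (- (real L * (H + \<eta>))) \<le> word_weight t \<sigma>"
        using wp[OF \<open>\<sigma> \<in> words I L\<close>] by (metis exp_le_cancel_iff exp_ln)+
    qed
    have "1/2 \<le> real (card T) * exp (- (real L * (H - \<eta>)))"
      using half sum_bounded_above[of T "word_weight t", OF ub] by simp
    then have "exp (real L * (H - \<eta>)) / 2 \<le> real (card T)"
      unfolding exp_minus by (simp add: field_simps)
    with sub lb show ?thesis by blast
  qed
  show ?thesis
  proof (intro exI[of _ "max 1 (nat \<lceil>2 * v / \<eta>\<^sup>2\<rceil>)"] allI impI)
    fix L assume "max 1 (nat \<lceil>2 * v / \<eta>\<^sup>2\<rceil>) \<le> L"
    then show "\<exists>T\<subseteq>words I L. exp (real L * (H - \<eta>)) / 2 \<le> real (card T) \<and>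
           (\<forall>\<sigma>\<in>T. exp (- (real L * (H + \<eta>))) \<le> word_weight t \<sigma>)"
      by (intro main) linarith+
  qed
qed

section \<open>Similarities of a Euclidean space\<close>

text \<open>Removing the translation and the factor \<kappa> leaves an isometry fixing 0, which is
  orthogonal and therefore onto in finite dimension.\<close>

lemma similarity_surj:
  fixes h :: "'b::euclidean_space \<Rightarrow> 'b"
  assumes "0 < \<kappa>" and h: "\<And>x y. dist (h x) (h y) = \<kappa> * dist x y"
  shows "surj h"
proof -
  define T where "T x = (h x - h 0) /\<^sub>R \<kappa>" for x
  have "dist (T x) (T y) = dist x y" for x y
  proof -
    have "T x - T y = (h x - h y) /\<^sub>R \<kappa>" by (simp add: T_def scaleR_diff_right[symmetric])
    then show ?thesis using h[of x y] \<open>0 < \<kappa>\<close> by (simp add: dist_norm)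
  qed
  then have "orthogonal_transformation T"
    by (auto simp: orthogonal_transformation_isometry T_def)
  then have "surj T" by (rule orthogonal_transformation_surj)
  show ?thesis
  proof (rule surjI)
    fix y
    have "T (inv T ((y - h 0) /\<^sub>R \<kappa>)) = (y - h 0) /\<^sub>R \<kappa>"
      using \<open>surj T\<close> by (rule surj_f_inv_f)
    then show "h (inv T ((y - h 0) /\<^sub>R \<kappa>)) = y"
      using \<open>0 < \<kappa>\<close> by (simp add: T_def)
  qed
qed

text \<open>The bound must not depend on the scale \<kappa> or the centre. Translating and rescaling
  moves \<open>S\<close> into \<open>cball 0 R\<close> with separation \<open>d\<close>; in a finite
  cover of that ball by balls of radius \<open>d/2\<close>, each contains at most one of the
  points.\<close>

lemma packing_bound:
  fixes R d :: real
  assumes "0 < d"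
  shows "\<exists>M. \<forall>\<kappa>>0. \<forall>a::'b::euclidean_space. \<forall>S. S \<subseteq> cball a (\<kappa> * R) \<longrightarrow>
     (\<forall>x\<in>S. \<forall>y\<in>S. x \<noteq> y \<longrightarrow> \<kappa> * d \<le> dist x y) \<longrightarrow> finite S \<and> card S \<le> M"
proof -
  have "\<exists>K::'b set. finite K \<and> cball 0 R \<subseteq> (\<Union>x\<in>K. ball x (d/2))"
    using compact_imp_seq_compact[OF compact_cball, THEN seq_compact_imp_totally_bounded] assms
    by (metis half_gt_zero)
  then obtain K :: "'b set" where K: "finite K" "cball 0 R \<subseteq> (\<Union>x\<in>K. ball x (d/2))" by blast
  show ?thesis
  proof (intro exI allI impI)
    fix \<kappa> :: real and a :: 'b and S
    assume \<kappa>: "0 < \<kappa>" and S: "S \<subseteq> cball a (\<kappa> * R)" 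
      and sep: "\<forall>x\<in>S. \<forall>y\<in>S. x \<noteq> y \<longrightarrow> \<kappa> * d \<le> dist x y"
    have "\<exists>k\<in>K. dist k ((x - a) /\<^sub>R \<kappa>) < d/2" if "x \<in> S" for x
    proof -
      have "norm (x - a) \<le> \<kappa> * R" using S that by (auto simp: dist_norm norm_minus_commute)
      then have "inverse \<kappa> * norm (x - a) \<le> R" using \<kappa> by (simp add: field_simps)
      then have "(x - a) /\<^sub>R \<kappa> \<in> cball 0 R" using \<kappa> by simp
      then show ?thesis using K by (auto simp: subset_iff)
    qed
    then obtain \<phi> where \<phi>: "\<And>x. x \<in> S \<Longrightarrow> \<phi> x \<in> K \<and> dist (\<phi> x) ((x - a) /\<^sub>R \<kappa>) < d/2" by metis
    have "inj_on \<phi> S"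
    proof (rule inj_onI, rule ccontr)
      fix x y assume xy: "x \<in> S" "y \<in> S" "\<phi> x = \<phi> y" "x \<noteq> y"
      have "dist ((x - a) /\<^sub>R \<kappa>) ((y - a) /\<^sub>R \<kappa>) < d"
        using \<phi>[OF xy(1)] \<phi>[OF xy(2)] xy(3) by (metis dist_commute dist_triangle_half_r)
      moreover have "dist ((x - a) /\<^sub>R \<kappa>) ((y - a) /\<^sub>R \<kappa>) = dist x y / \<kappa>"
        using \<kappa> by (simp add: dist_norm scaleR_diff_right[symmetric] divide_inverse_commute)
      ultimately have "dist x y < \<kappa> * d" using \<kappa> by (metis pos_divide_less_eq mult.commute)
      with sep xy show False by force
    qed
    moreover have "\<phi> ` S \<subseteq> K" using \<phi> by auto
    ultimately show "finite S \<and> card S \<le> card K"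
      using K(1) by (meson card_inj_on_le finite_imageD finite_subset)
  qed
qed

section \<open>Self-similar measures\<close>

text \<open>The index type is free so that pairs of indices are covered, and the open set is a
  parameter so that the product system can use a product of open sets. The common ratio
  \<open>c\<close> gives all cylinders of one level the same size.\<close>

locale self_similar_measure =
  fixes I :: "'i set" and \<theta> :: "'i \<Rightarrow> 'b::euclidean_space \<Rightarrow> 'b" and w :: "'i \<Rightarrow> real"
    and c r :: real and \<nu> :: "'b measure" and U :: "'b set"
  assumes finite_I: "finite I" and card_I: "2 \<le> card I"
    and c_pos: "0 < c" and c_less: "c < 1" and r_pos: "0 < r"
    and dist_\<theta>: "\<And>i x y. i \<in> I \<Longrightarrow> dist (\<theta> i x) (\<theta> i y) = c * dist x y"
    and w_pos: "\<And>i. i \<in> I \<Longrightarrow> 0 < w i" and w_sum: "(\<Sum>i\<in>I. w i) = 1"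
    and invariant: "invariant_measure I \<theta> w \<nu>"
    and open_U: "open U" and U_nonempty: "U \<noteq> {}"
    and \<theta>_U: "\<And>i. i \<in> I \<Longrightarrow> \<theta> i ` U \<subseteq> U"
    and \<theta>_U_disjoint: "\<And>i j. i \<in> I \<Longrightarrow> j \<in> I \<Longrightarrow> i \<noteq> j \<Longrightarrow> \<theta> i ` U \<inter> \<theta> j ` U = {}"
begin

sublocale prob_space \<nu>
  using invariant by (simp add: invariant_measure_def)

lemma sets_\<nu> [measurable_cong, simp]: "sets \<nu> = sets borel"
  using invariant by (simp add: invariant_measure_def)

lemma space_\<nu> [simp]: "space \<nu> = UNIV"
  using sets_eq_imp_space_eq[OF sets_\<nu>] by simp

lemma emeasure_invariant:
  "A \<in> sets borel \<Longrightarrow> emeasure \<nu> A = (\<Sum>k\<in>I. ennreal (w k) * emeasure \<nu> (\<theta> k -` A))"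
  using invariant by (simp add: invariant_measure_def)

lemma measurable_\<theta>:
  assumes "i \<in> I" shows "\<theta> i \<in> borel_measurable \<nu>"
proof -
  have "c-lipschitz_on UNIV (\<theta> i)"
    using c_pos dist_\<theta>[OF assms] by (intro lipschitz_onI) auto
  then have "\<theta> i \<in> borel_measurable borel"
    by (intro borel_measurable_continuous_onI lipschitz_on_continuous_on)
  then show ?thesis by (simp cong: measurable_cong_sets)
qed

lemma measurable_comp_\<theta>:
  "F \<in> borel_measurable \<nu> \<Longrightarrow> i \<in> I \<Longrightarrow> (\<lambda>z. F (\<theta> i z)) \<in> borel_measurable \<nu>"
  by (rule measurable_compose[OF measurable_\<theta>]) (simp_all cong: measurable_cong_sets)

lemma vimage_\<theta>_sets: "i \<in> I \<Longrightarrow> A \<in> sets borel \<Longrightarrow> \<theta> i -` A \<in> sets borel"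
  using measurable_sets[OF measurable_\<theta>, of i A] by simp

text \<open>Induction over nonnegative measurable functions, starting from indicators, where the
  claim is the invariance of \<nu> on sets; monotone limits pass through the finite sum over
  \<open>I\<close>.\<close>

lemma nn_integral_invariant:
  assumes "F \<in> borel_measurable \<nu>"
  shows "(\<integral>\<^sup>+z. F z \<partial>\<nu>) = (\<Sum>k\<in>I. ennreal (w k) * (\<integral>\<^sup>+z. F (\<theta> k z) \<partial>\<nu>))"
  using assms
proof (induction rule: borel_measurable_induct)
  case (cong f g)
  then have "f = g" by auto
  with cong show ?case by simp
next
  case (set A)
  have "(\<integral>\<^sup>+z. indicator A (\<theta> k z) \<partial>\<nu>) = emeasure \<nu> (\<theta> k -` A)" if "k \<in> I" for k
  proof -
    have "(\<integral>\<^sup>+z. indicator A (\<theta> k z) \<partial>\<nu>) = (\<integral>\<^sup>+z. indicator (\<theta> k -` A) z \<partial>\<nu>)"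
      by (simp add: indicator_def)
    also have "\<dots> = emeasure \<nu> (\<theta> k -` A)"
      using set that by (intro nn_integral_indicator) (simp add: vimage_\<theta>_sets)
    finally show ?thesis .
  qed
  with set show ?case by (simp add: emeasure_invariant)
next
  case (mult f a)
  have "(\<lambda>z. f (\<theta> k z)) \<in> borel_measurable \<nu>" if "k \<in> I" for k
    using mult(2) that by (rule measurable_comp_\<theta>)
  then show ?case
    using mult by (simp add: nn_integral_cmult sum_distrib_left mult_ac)
next
  case (add f g)
  have "(\<lambda>z. f (\<theta> k z)) \<in> borel_measurable \<nu>" "(\<lambda>z. g (\<theta> k z)) \<in> borel_measurable \<nu>" if "k \<in> I" for k
    using add that by (auto intro: measurable_comp_\<theta>)
  then show ?case
    using add by (simp add: nn_integral_add sum.distrib distrib_left)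
next
  case (seq F)
  have m: "(\<lambda>z. F i (\<theta> k z)) \<in> borel_measurable \<nu>" if "k \<in> I" for k i
    using seq(1) that by (rule measurable_comp_\<theta>)
  have inc: "incseq (\<lambda>i z. F i (\<theta> k z))" for k
    using \<open>incseq F\<close> by (auto simp: incseq_def le_fun_def)
  have "(\<integral>\<^sup>+z. (SUP i. F i) z \<partial>\<nu>) = (SUP i. \<integral>\<^sup>+z. F i z \<partial>\<nu>)"
    using nn_integral_monotone_convergence_SUP[OF \<open>incseq F\<close> seq(1)] by (simp only: SUP_apply)
  also have "\<dots> = (SUP i. \<Sum>k\<in>I. ennreal (w k) * (\<integral>\<^sup>+z. F i (\<theta> k z) \<partial>\<nu>))"
    by (simp add: seq)
  also have "\<dots> = (\<Sum>k\<in>I. SUP i. ennreal (w k) * (\<integral>\<^sup>+z. F i (\<theta> k z) \<partial>\<nu>))"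
    using inc by (intro ennreal_SUP_sum)
       (auto simp: incseq_def le_fun_def intro!: mult_left_mono nn_integral_mono)
  also have "\<dots> = (\<Sum>k\<in>I. ennreal (w k) * (\<integral>\<^sup>+z. (SUP i. F i) (\<theta> k z) \<partial>\<nu>))"
  proof (rule sum.cong[OF refl])
    fix k assume "k \<in> I"
    then show "(SUP i. ennreal (w k) * (\<integral>\<^sup>+z. F i (\<theta> k z) \<partial>\<nu>)) = ennreal (w k) * (\<integral>\<^sup>+z. (SUP i. F i) (\<theta> k z) \<partial>\<nu>)"
      using nn_integral_monotone_convergence_SUP[OF inc m, of k]
      by (simp only: SUP_apply SUP_mult_left_ennreal)
  qed
  finally show ?case .
qed

section \<open>Cylinder maps of words and the support of the measure\<close>

abbreviation act :: "'i list \<Rightarrow> 'b \<Rightarrow> 'b" where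
  "act \<equiv> foldr \<theta>"

lemma dist_act:
  assumes "\<sigma> \<in> words I L"
  shows "dist (act \<sigma> x) (act \<sigma> y) = c ^ L * dist x y"
proof -
  have "set \<sigma> \<subseteq> I \<Longrightarrow> dist (act \<sigma> x) (act \<sigma> y) = c ^ length \<sigma> * dist x y"
    by (induction \<sigma>) (auto simp: dist_\<theta>)
  with assms show ?thesis by (simp add: words_def)
qed

lemma nn_integral_words:
  assumes "F \<in> borel_measurable \<nu>"
  shows "(\<integral>\<^sup>+z. F z \<partial>\<nu>) = (\<Sum>\<sigma>\<in>words I L. ennreal (word_weight w \<sigma>) * (\<integral>\<^sup>+z. F (act \<sigma> z) \<partial>\<nu>))"
  using assms
proof (induction L arbitrary: F)
  case (Suc L)
  have "(\<integral>\<^sup>+z. F z \<partial>\<nu>) = (\<Sum>k\<in>I. ennreal (w k) * (\<integral>\<^sup>+z. F (\<theta> k z) \<partial>\<nu>))"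
    by (rule nn_integral_invariant) fact
  also have "\<dots> = (\<Sum>k\<in>I. \<Sum>\<sigma>\<in>words I L. ennreal (w k) *
      (ennreal (word_weight w \<sigma>) * (\<integral>\<^sup>+z. F (\<theta> k (act \<sigma> z)) \<partial>\<nu>)))"
  proof (rule sum.cong[OF refl])
    fix k assume "k \<in> I"
    then have "(\<lambda>z. F (\<theta> k z)) \<in> borel_measurable \<nu>"
      by (rule measurable_comp_\<theta>[OF Suc.prems])
    from Suc.IH[OF this]
    show "ennreal (w k) * (\<integral>\<^sup>+z. F (\<theta> k z) \<partial>\<nu>) = (\<Sum>\<sigma>\<in>words I L. ennreal (w k) *
      (ennreal (word_weight w \<sigma>) * (\<integral>\<^sup>+z. F (\<theta> k (act \<sigma> z)) \<partial>\<nu>)))"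
      by (simp add: sum_distrib_left)
  qed
  also have "\<dots> = (\<Sum>\<sigma>\<in>words I (Suc L). ennreal (word_weight w \<sigma>) * (\<integral>\<^sup>+z. F (act \<sigma> z) \<partial>\<nu>))"
    unfolding sum_words_Suc
    by (intro sum.cong refl)
      (simp add: ennreal_mult less_imp_le w_pos word_weight_pos[OF w_pos] mult.assoc)
  finally show ?case .
qed simp

text \<open>Each map sends the ball of radius \<rho> about 0 into the ball of radius
  \<open>c * \<rho> + b\<close>, so by invariance the first ball has no more mass than the second.
  Iteration drives the radius towards \<open>a\<close>; hence no ball about 0 outweighs the one of
  radius \<open>a + 1\<close>, which therefore has full mass.\<close>

lemma bounded_support: "\<exists>R>0. AE z in \<nu>. z \<in> cball 0 R"
proof -
  define b where "b = (\<Sum>k\<in>I. norm (\<theta> k 0))"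
  \<comment> \<open>The fixed point of the map sending a radius \<rho> to
    \<open>c * \<rho> + b\<close>.\<close>
  define a where "a = b / (1 - c)"
  define F where "F \<rho> = emeasure \<nu> (cball 0 \<rho>)" for \<rho>
  have b: "norm (\<theta> k 0) \<le> b" if "k \<in> I" for k
    unfolding b_def using that finite_I by (intro member_le_sum) auto
  have "0 \<le> b" unfolding b_def by (intro sum_nonneg) auto
  then have "0 \<le> a" using c_less by (simp add: a_def)
  have mono: "F \<rho> \<le> F \<rho>'" if "\<rho> \<le> \<rho>'" for \<rho> \<rho>'
    unfolding F_def using that by (intro emeasure_mono) auto
  have step: "F \<rho> \<le> F (c * \<rho> + b)" for \<rho>
  proof -
    have "F \<rho> = (\<Sum>k\<in>I. ennreal (w k)) * F \<rho>"
      using w_sum w_pos by (subst sum_ennreal) (auto intro: less_imp_le)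
    also have "\<dots> = (\<Sum>k\<in>I. ennreal (w k) * F \<rho>)" by (rule sum_distrib_right)
    also have "\<dots> \<le> (\<Sum>k\<in>I. ennreal (w k) * emeasure \<nu> (\<theta> k -` cball 0 (c * \<rho> + b)))"
    proof (intro sum_mono mult_left_mono)
      fix k assume k: "k \<in> I"
      have "cball 0 \<rho> \<subseteq> \<theta> k -` cball 0 (c * \<rho> + b)"
      proof
        fix x :: 'b assume "x \<in> cball 0 \<rho>"
        then have "c * norm x \<le> c * \<rho>" using c_pos by simp
        moreover have "norm (\<theta> k x) \<le> norm (\<theta> k 0) + dist (\<theta> k x) (\<theta> k 0)"
          unfolding dist_norm by (rule norm_triangle_sub)
        ultimately show "x \<in> \<theta> k -` cball 0 (c * \<rho> + b)"
          using b[OF k] dist_\<theta>[OF k, of x 0] by simp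
      qed
      then show "F \<rho> \<le> emeasure \<nu> (\<theta> k -` cball 0 (c * \<rho> + b))"
        unfolding F_def using k by (intro emeasure_mono) (auto intro: vimage_\<theta>_sets)
    qed simp
    also have "\<dots> = F (c * \<rho> + b)"
      unfolding F_def by (rule emeasure_invariant[symmetric]) simp
    finally show ?thesis .
  qed
  have iter: "F \<rho> \<le> F (a + c ^ n * (\<rho> - a))" for \<rho> n
  proof (induction n)
    case (Suc n)
    have "a * (1 - c) = b" using c_less by (simp add: a_def)
    then have "c * (a + c ^ n * (\<rho> - a)) + b = a + c ^ Suc n * (\<rho> - a)"
      by (simp add: algebra_simps)
    with Suc step[of "a + c ^ n * (\<rho> - a)"] show ?case by (metis order_trans)
  qed simp
  have bound: "F \<rho> \<le> F (a + 1)" for \<rho>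
  proof -
    have "(\<lambda>n. c ^ n * (\<rho> - a)) \<longlonglongrightarrow> 0 * (\<rho> - a)"
      using c_pos c_less by (intro tendsto_intros LIMSEQ_power_zero) simp
    then have "eventually (\<lambda>n. c ^ n * (\<rho> - a) < 1) sequentially"
      by (intro order_tendstoD) auto
    then obtain n where "c ^ n * (\<rho> - a) < 1" by (metis eventually_happens' sequentially_bot)
    then have "F (a + c ^ n * (\<rho> - a)) \<le> F (a + 1)" by (intro mono) simp
    with iter show ?thesis by (metis order_trans)
  qed
  have "(\<Union>n. cball (0::'b) (real n)) = UNIV"
    by (auto intro: real_arch_simple)
  then have "emeasure \<nu> UNIV = (SUP n. F (real n))"
    unfolding F_def by (subst SUP_emeasure_incseq) (auto simp: incseq_def)
  also have "\<dots> \<le> F (a + 1)" by (intro SUP_least bound)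
  finally have "1 \<le> F (a + 1)" using emeasure_space_1 by simp
  then have "emeasure \<nu> (cball 0 (a + 1)) = 1"
    using emeasure_le_1[of "cball 0 (a + 1)"] unfolding F_def by (rule antisym[rotated])
  then have "prob (cball 0 (a + 1)) = 1" by (simp add: measure_def)
  then have "AE z in \<nu>. z \<in> cball 0 (a + 1)" by (rule AE_prob_1)
  with \<open>0 \<le> a\<close> show ?thesis by (intro exI[of _ "a + 1"]) auto
qed

section \<open>Separation of cylinders from the open set condition\<close>

lemma act_U: "\<sigma> \<in> words I L \<Longrightarrow> act \<sigma> ` U \<subseteq> U"
proof -
  have "set \<sigma> \<subseteq> I \<Longrightarrow> act \<sigma> ` U \<subseteq> U"
    by (induction \<sigma>) (use \<theta>_U in \<open>auto simp: image_subset_iff\<close>)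
  then show "\<sigma> \<in> words I L \<Longrightarrow> act \<sigma> ` U \<subseteq> U" by (simp add: words_def)
qed

text \<open>If the first letters differ, the open set condition separates the images; if they agree,
  the common first map is injective and preserves the disjointness obtained for the tails.\<close>

lemma act_U_disjoint:
  assumes "\<sigma> \<in> words I L" "\<tau> \<in> words I L" "\<sigma> \<noteq> \<tau>"
  shows "act \<sigma> ` U \<inter> act \<tau> ` U = {}"
  using assms
proof (induction L arbitrary: \<sigma> \<tau>)
  case (Suc L)
  obtain i \<sigma>' j \<tau>' where eq: "\<sigma> = i # \<sigma>'" "\<tau> = j # \<tau>'"
    using Suc.prems by (auto simp: words_def length_Suc_conv)
  then have ij: "i \<in> I" "j \<in> I" and w: "\<sigma>' \<in> words I L" "\<tau>' \<in> words I L"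
    using Suc.prems by (auto simp: words_def)
  show ?case
  proof (cases "i = j")
    case True
    have "inj (\<theta> i)"
    proof (rule injI)
      fix x y assume "\<theta> i x = \<theta> i y"
      then show "x = y" using dist_\<theta>[OF ij(1), of x y] c_pos by simp
    qed
    moreover have "act \<sigma>' ` U \<inter> act \<tau>' ` U = {}"
      using Suc.IH[OF w] Suc.prems(3) True eq by simp
    moreover have "act \<sigma> ` U = \<theta> i ` act \<sigma>' ` U" "act \<tau> ` U = \<theta> i ` act \<tau>' ` U"
      by (simp_all add: eq True image_image)
    ultimately show ?thesis by (simp add: image_Int[symmetric])
  next
    case False
    have "act \<sigma> ` U \<subseteq> \<theta> i ` U" "act \<tau> ` U \<subseteq> \<theta> j ` U"
      using act_U[OF w(1)] act_U[OF w(2)] by (auto simp: eq image_subset_iff)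
    with \<theta>_U_disjoint[OF ij False] show ?thesis by blast
  qed
qed simp

text \<open>For words of level \<open>L\<close> whose cylinder comes within \<open>c ^ L\<close> of
  a fixed point \<open>b\<close>, the points \<open>act \<sigma> u\<close> lie in a ball about
  \<open>b\<close> of radius comparable to \<open>c ^ L\<close> and are separated by a multiple of
  \<open>c ^ L\<close>. Packing bounds their number independently of \<open>L\<close>; adding up
  over the points of \<open>B\<close> gives the factor \<open>card B\<close>.\<close>

lemma bounded_overlap:
  "\<exists>M\<ge>1. \<forall>L B. finite B \<longrightarrow> B \<noteq> {} \<longrightarrow>
     card {\<sigma>\<in>words I L. \<exists>z\<in>cball 0 R. infdist (act \<sigma> z) B < c ^ L} \<le> M * card B"
proof -
  obtain u \<rho> where \<rho>: "0 < \<rho>" "ball u \<rho> \<subseteq> U"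
    using open_U U_nonempty by (meson all_not_in_conv openE)
  have sep: "c ^ L * \<rho> \<le> dist (act \<sigma> u) (act \<tau> u)"
    if "\<sigma> \<in> words I L" "\<tau> \<in> words I L" "\<sigma> \<noteq> \<tau>" for L \<sigma> \<tau>
  proof (rule ccontr)
    assume *: "\<not> ?thesis"
    \<comment> \<open>Surjectivity makes every point closer than \<open>c ^ L * \<rho>\<close> to
      \<open>act \<tau> u\<close> an image of a point of \<open>ball u \<rho>\<close>, so
      \<open>act \<sigma> u\<close> would lie in both images of \<open>U\<close>.\<close>
    have "surj (act \<tau>)"
      using c_pos dist_act[OF that(2)] by (intro similarity_surj[of "c ^ L"]) auto
    then obtain x where x: "act \<sigma> u = act \<tau> x" by (metis surjD)
    then have "c ^ L * dist x u < c ^ L * \<rho>" using * dist_act[OF that(2), of x u] by simp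
    then have "x \<in> U" using \<rho> c_pos by (auto simp: dist_commute subset_iff)
    moreover have "u \<in> U" using \<rho> by auto
    ultimately show False using act_U_disjoint[OF that] x by blast
  qed
  \<comment> \<open>In units of \<open>c ^ L\<close>: 1 for the distance from \<open>b\<close> to
    \<open>act \<sigma> z\<close>, and \<open>R + norm u\<close> for the distance between
    \<open>z\<close> and \<open>u\<close>.\<close>
  define R' where "R' = 1 + R + norm u"
  from packing_bound[OF \<rho>(1), of R', where 'b = 'b]
  obtain M where M: "\<forall>\<kappa>>0. \<forall>a::'b. \<forall>S. S \<subseteq> cball a (\<kappa> * R') \<longrightarrow>
     (\<forall>x\<in>S. \<forall>y\<in>S. x \<noteq> y \<longrightarrow> \<kappa> * \<rho> \<le> dist x y) \<longrightarrow> finite S \<and> card S \<le> M" ..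
  have "card {\<sigma>\<in>words I L. \<exists>z\<in>cball 0 R. infdist (act \<sigma> z) B < c ^ L} \<le> max 1 M * card B"
    if B: "finite B" "B \<noteq> {}" for L B
  proof -
    define W where "W b = {\<sigma>\<in>words I L. \<exists>z\<in>cball 0 R. dist (act \<sigma> z) b < c ^ L}" for b
    have finW: "finite (W b)" for b
      unfolding W_def by (intro finite_Collect_conjI disjI1) (simp add: finite_words[OF finite_I])
    have card_W: "card (W b) \<le> M" for b
    proof -
      have inj: "inj_on (\<lambda>\<sigma>. act \<sigma> u) (W b)"
      proof (rule inj_onI, rule ccontr)
        fix \<sigma> \<tau> assume "\<sigma> \<in> W b" "\<tau> \<in> W b" "act \<sigma> u = act \<tau> u" "\<sigma> \<noteq> \<tau>"
        then have "c ^ L * \<rho> \<le> 0" using sep[of \<sigma> L \<tau>] by (simp add: W_def)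
        moreover have "0 < c ^ L * \<rho>" using c_pos \<rho> by simp
        ultimately show False by simp
      qed
      have "card ((\<lambda>\<sigma>. act \<sigma> u) ` W b) \<le> M"
      proof (rule M[rule_format, of "c ^ L" _ b, THEN conjunct2])
        show "(\<lambda>\<sigma>. act \<sigma> u) ` W b \<subseteq> cball b (c ^ L * R')"
        proof (rule image_subsetI)
          fix \<sigma> assume "\<sigma> \<in> W b"
          then obtain z where \<sigma>: "\<sigma> \<in> words I L" and z: "norm z \<le> R" "dist (act \<sigma> z) b < c ^ L"
            by (auto simp: W_def)
          have "dist u z \<le> norm u + R"
            using z norm_triangle_ineq4[of u z] by (simp add: dist_norm)
          then have "c ^ L * dist u z \<le> c ^ L * (norm u + R)"
            using c_pos by (intro mult_left_mono) auto
          then have "dist (act \<sigma> u) b \<le> c ^ L * (norm u + R) + c ^ L"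
            using dist_triangle[of "act \<sigma> u" b "act \<sigma> z"] z dist_act[OF \<sigma>, of u z] by simp
          then show "act \<sigma> u \<in> cball b (c ^ L * R')"
            by (simp add: R'_def algebra_simps dist_commute)
        qed
        show "0 < c ^ L" using c_pos by simp
        fix x y assume "x \<in> (\<lambda>\<sigma>. act \<sigma> u) ` W b" "y \<in> (\<lambda>\<sigma>. act \<sigma> u) ` W b" "x \<noteq> y"
        then obtain \<sigma> \<tau> where "\<sigma> \<in> W b" "\<tau> \<in> W b" "x = act \<sigma> u" "y = act \<tau> u" "\<sigma> \<noteq> \<tau>" by blast
        then show "c ^ L * \<rho> \<le> dist x y" using sep[of \<sigma> L \<tau>] by (simp add: W_def)
      qed
      with card_image[OF inj] show ?thesis by simp
    qed
    have "{\<sigma>\<in>words I L. \<exists>z\<in>cball 0 R. infdist (act \<sigma> z) B < c ^ L} \<subseteq> (\<Union>b\<in>B. W b)"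
    proof
      fix \<sigma> assume "\<sigma> \<in> {\<sigma>\<in>words I L. \<exists>z\<in>cball 0 R. infdist (act \<sigma> z) B < c ^ L}"
      then obtain z where z: "\<sigma> \<in> words I L" "z \<in> cball 0 R" "infdist (act \<sigma> z) B < c ^ L" by blast
      obtain b where "b \<in> B" "infdist (act \<sigma> z) B = dist (act \<sigma> z) b"
        using infdist_attains_inf[OF finite_imp_closed[OF B(1)] B(2)] by blast
      then have "\<sigma> \<in> W b"
        unfolding W_def using z by (intro CollectI conjI bexI[of _ z]) simp_all
      with \<open>b \<in> B\<close> show "\<sigma> \<in> (\<Union>b\<in>B. W b)" by blast
    qed
    then have "card {\<sigma>\<in>words I L. \<exists>z\<in>cball 0 R. infdist (act \<sigma> z) B < c ^ L} \<le> card (\<Union>b\<in>B. W b)"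
      using B finW by (intro card_mono) auto
    also have "\<dots> \<le> (\<Sum>b\<in>B. card (W b))" by (rule card_UN_le) fact
    also have "\<dots> \<le> (\<Sum>b\<in>B. M)" by (intro sum_mono card_W)
    also have "\<dots> \<le> max 1 M * card B" by (simp add: mult.commute)
    finally show ?thesis .
  qed
  \<comment> \<open>The maximum with 1 secures a constant of at least 1, which
    \<open>quantization_lower\<close> uses to pass from \<open>M * n\<close> down to
    \<open>n\<close>.\<close>
  then show ?thesis by (intro exI[of _ "max 1 M"]) auto
qed

end

section \<open>The quantization dimension\<close>

text \<open>In the equation for the dimension \<open>D\<close>, the number \<open>s\<close> is the
  exponent \<open>D / (r + D)\<close>; solving for \<open>D\<close> gives
  \<open>r * s / (1 - s)\<close>.\<close>

locale self_similar_exponent = self_similar_measure +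
  fixes s :: real
  assumes s_pos: "0 < s" and s_less: "s < 1"
    and s_sum: "(\<Sum>i\<in>I. (w i * c powr r) powr s) = 1"
begin

definition u :: "'a \<Rightarrow> real" where "u i = w i * c powr r"

definition t :: "'a \<Rightarrow> real" where "t i = u i powr s"

definition H :: real where "H = - (\<Sum>i\<in>I. t i * ln (t i))"

lemma u_pos: "i \<in> I \<Longrightarrow> 0 < u i"
  using w_pos c_pos by (simp add: u_def)

lemma u_less_1: assumes "i \<in> I" shows "u i < 1"
proof -
  have "w i \<le> (\<Sum>i\<in>I. w i)"
    using assms finite_I w_pos by (intro member_le_sum) (auto intro: less_imp_le)
  then have "w i \<le> 1" by (simp add: w_sum)
  moreover have "c powr r < 1" using powr_less_mono2[OF r_pos _ c_less] c_pos by simp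
  ultimately have "w i * c powr r < 1 * 1"
    using w_pos[OF assms] c_pos by (intro mult_le_less_imp_less) auto
  then show ?thesis by (simp add: u_def)
qed

lemma t_pos: "i \<in> I \<Longrightarrow> 0 < t i"
  using u_pos[of i] by (simp add: t_def)

lemma t_sum: "(\<Sum>i\<in>I. t i) = 1"
  using s_sum by (simp add: t_def u_def)

lemma H_pos: "0 < H"
proof -
  have "t i * ln (t i) < 0" if "i \<in> I" for i
    using t_pos[OF that] u_pos[OF that] u_less_1[OF that] s_pos
    by (simp add: t_def ln_powr mult_less_0_iff)
  moreover have "I \<noteq> {}" using card_I by auto
  ultimately have "(\<Sum>i\<in>I. t i * ln (t i)) < (\<Sum>i\<in>I. 0)"
    by (intro sum_strict_mono finite_I) auto
  then show ?thesis by (simp add: H_def)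
qed

section \<open>Upper bound for the quantization error\<close>

lemma measurable_error [measurable]:
  "(\<lambda>z. ennreal (infdist z B powr r)) \<in> borel_measurable \<nu>"
proof -
  have "(\<lambda>z. infdist z B) \<in> borel_measurable borel"
    by (intro borel_measurable_continuous_onI continuous_on_infdist continuous_on_id)
  then have "(\<lambda>z. ennreal (infdist z B powr r)) \<in> borel_measurable borel" by measurable
  then show ?thesis by (simp cong: measurable_cong_sets)
qed

text \<open>The bound is indexed by a scale \<epsilon> because gluing relates \<epsilon> to the
  scales \<open>\<epsilon> / u k\<close>. Scales between 1 and \<open>1 / m\<close> are served by
  the single point 0; smaller ones are reached by induction in factors of \<open>x\<close>.\<close>

lemma quantization_upper:
  "\<exists>a>0. \<exists>b>0. \<forall>\<epsilon>. 0 < \<epsilon> \<longrightarrow> \<epsilon> \<le> 1 \<longrightarrow> (\<exists>B. finite B \<and> B \<noteq> {} \<and> real (card B) \<le> a * \<epsilon> powr - s \<and>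
      (\<integral>\<^sup>+z. ennreal (infdist z B powr r) \<partial>\<nu>) \<le> ennreal (b * \<epsilon> powr (1 - s)))"
proof -
  obtain R where R: "0 < R" "AE z in \<nu>. z \<in> cball 0 R" using bounded_support by blast
  define m where "m = Min (u ` I)"
  define x where "x = Max (u ` I)"
  have I0: "I \<noteq> {}" using card_I by auto
  have m: "0 < m" "\<And>i. i \<in> I \<Longrightarrow> m \<le> u i"
    unfolding m_def using finite_I I0 u_pos by auto
  have x: "0 < x" "x < 1" "\<And>i. i \<in> I \<Longrightarrow> u i \<le> x"
    unfolding x_def using finite_I I0 u_pos u_less_1 by (auto simp: Max_gr_iff)
  \<comment> \<open>This makes \<open>a * \<epsilon> powr - s\<close> at least 1 for every positive
    \<epsilon> up to \<open>1 / m\<close>, so that one point is allowed there.\<close>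
  define a where "a = m powr - s"
  \<comment> \<open>Bounds the error of the single point 0, since almost all of the mass lies in the
    ball of radius \<open>R\<close>.\<close>
  define b where "b = R powr r"
  have ab: "0 < a" "0 < b" using m R by (auto simp: a_def b_def)
  define Q where "Q \<epsilon> \<longleftrightarrow> (\<exists>B. finite B \<and> B \<noteq> {} \<and> real (card B) \<le> a * \<epsilon> powr - s \<and>
      (\<integral>\<^sup>+z. ennreal (infdist z B powr r) \<partial>\<nu>) \<le> ennreal (b * \<epsilon> powr (1 - s)))" for \<epsilon>
  have base: "Q \<epsilon>" if "1 \<le> \<epsilon>" "\<epsilon> \<le> 1 / m" for \<epsilon>
  proof -
    have "(m * \<epsilon>) powr s \<le> 1 powr s"
      using that m s_pos by (intro powr_mono2) (auto simp: field_simps)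
    then have "1 \<le> inverse ((m * \<epsilon>) powr s)"
      using that m by (intro one_le_inverse) auto
    then have "real (card {0::'b}) \<le> a * \<epsilon> powr - s"
      using that m by (simp add: a_def powr_mult powr_minus)
    moreover have "(\<integral>\<^sup>+z. ennreal (infdist z {0} powr r) \<partial>\<nu>) \<le> ennreal (b * \<epsilon> powr (1 - s))"
    proof -
      have "(\<integral>\<^sup>+z. ennreal (infdist z {0} powr r) \<partial>\<nu>) \<le> (\<integral>\<^sup>+z. ennreal b \<partial>\<nu>)"
        using R(2) by (intro nn_integral_mono_AE, eventually_elim)
          (auto simp: b_def r_pos less_imp_le intro!: ennreal_leI powr_mono2)
      also have "\<dots> = ennreal b" using emeasure_space_1 by simp
      also have "\<dots> \<le> ennreal (b * \<epsilon> powr (1 - s))"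
        using that s_less ab by (intro ennreal_leI) (simp add: ge_one_powr_ge_zero)
      finally show ?thesis .
    qed
    ultimately show ?thesis unfolding Q_def by (intro exI[of _ "{0}"]) simp
  qed
  have step: "Q \<epsilon>" if \<epsilon>: "0 < \<epsilon>" and Qk: "\<And>k. k \<in> I \<Longrightarrow> Q (\<epsilon> / u k)" for \<epsilon>
  proof -
    have "\<exists>A. \<forall>k\<in>I. finite (A k) \<and> A k \<noteq> {} \<and> real (card (A k)) \<le> a * (\<epsilon> / u k) powr - s \<and>
      (\<integral>\<^sup>+z. ennreal (infdist z (A k) powr r) \<partial>\<nu>) \<le> ennreal (b * (\<epsilon> / u k) powr (1 - s))"
      by (rule bchoice) (use Qk in \<open>simp add: Q_def\<close>)
    then obtain A where finA: "\<And>k. k \<in> I \<Longrightarrow> finite (A k)" and neA: "\<And>k. k \<in> I \<Longrightarrow> A k \<noteq> {}"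
      and cardA: "\<And>k. k \<in> I \<Longrightarrow> real (card (A k)) \<le> a * (\<epsilon> / u k) powr - s"
      and intA: "\<And>k. k \<in> I \<Longrightarrow> (\<integral>\<^sup>+z. ennreal (infdist z (A k) powr r) \<partial>\<nu>) \<le> ennreal (b * (\<epsilon> / u k) powr (1 - s))"
      by blast
    define B where "B = (\<Union>k\<in>I. \<theta> k ` A k)"
    have "finite B" "B \<noteq> {}" using finite_I finA neA I0 by (auto simp: B_def)
    moreover have "real (card B) \<le> a * \<epsilon> powr - s"
    proof -
      have "card B \<le> (\<Sum>k\<in>I. card (\<theta> k ` A k))" unfolding B_def by (rule card_UN_le[OF finite_I])
      also have "\<dots> \<le> (\<Sum>k\<in>I. card (A k))" by (intro sum_mono card_image_le finA)
      finally have "real (card B) \<le> (\<Sum>k\<in>I. real (card (A k)))" by (metis of_nat_le_iff of_nat_sum)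
      also have "\<dots> \<le> (\<Sum>k\<in>I. a * \<epsilon> powr - s * t k)"
      proof (rule sum_mono)
        fix k assume k: "k \<in> I"
        \<comment> \<open>The factor produced by the change of scale is exactly \<open>t k\<close>,
          so the cardinalities add up to the bound at \<epsilon> by \<open>t_sum\<close>.\<close>
        have "a * (\<epsilon> / u k) powr - s = a * \<epsilon> powr - s * t k"
          using \<epsilon> u_pos[OF k] by (simp add: t_def powr_divide powr_minus field_simps)
        with cardA[OF k] show "real (card (A k)) \<le> a * \<epsilon> powr - s * t k" by simp
      qed
      also have "\<dots> = a * \<epsilon> powr - s" by (simp add: sum_distrib_left[symmetric] t_sum)
      finally show ?thesis .
    qed
    moreover have "(\<integral>\<^sup>+z. ennreal (infdist z B powr r) \<partial>\<nu>) \<le> ennreal (b * \<epsilon> powr (1 - s))"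
    proof -
      have "(\<integral>\<^sup>+z. ennreal (infdist z B powr r) \<partial>\<nu>)
          = (\<Sum>k\<in>I. ennreal (w k) * (\<integral>\<^sup>+z. ennreal (infdist (\<theta> k z) B powr r) \<partial>\<nu>))"
        by (rule nn_integral_invariant) (rule measurable_error)
      also have "\<dots> \<le> (\<Sum>k\<in>I. ennreal (b * \<epsilon> powr (1 - s) * t k))"
      proof (rule sum_mono)
        fix k assume k: "k \<in> I"
        \<comment> \<open>A nearest point of \<open>A k\<close> is sent into \<open>B\<close> by
          \<open>\<theta> k\<close>, and distances shrink by \<open>c\<close>.\<close>
        have "infdist (\<theta> k z) B \<le> c * infdist z (A k)" for z
        proof -
          obtain y where y: "y \<in> A k" "infdist z (A k) = dist z y"
            using infdist_attains_inf[OF finite_imp_closed[OF finA[OF k]] neA[OF k]] by blast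
          have "infdist (\<theta> k z) B \<le> dist (\<theta> k z) (\<theta> k y)"
            using y k by (intro infdist_le) (auto simp: B_def)
          then show ?thesis by (simp add: y dist_\<theta>[OF k])
        qed
        then have "ennreal (infdist (\<theta> k z) B powr r) \<le> ennreal (c powr r) * ennreal (infdist z (A k) powr r)" for z
          using c_pos r_pos
          by (subst ennreal_mult[symmetric]) (auto simp: powr_mult[symmetric] infdist_nonneg intro!: ennreal_leI powr_mono2)
        then have "(\<integral>\<^sup>+z. ennreal (infdist (\<theta> k z) B powr r) \<partial>\<nu>)
            \<le> (\<integral>\<^sup>+z. ennreal (c powr r) * ennreal (infdist z (A k) powr r) \<partial>\<nu>)"
          by (intro nn_integral_mono) simp
        also have "\<dots> = ennreal (c powr r) * (\<integral>\<^sup>+z. ennreal (infdist z (A k) powr r) \<partial>\<nu>)"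
          by (rule nn_integral_cmult) (rule measurable_error)
        also have "\<dots> \<le> ennreal (c powr r) * ennreal (b * (\<epsilon> / u k) powr (1 - s))"
          by (intro mult_left_mono intA k) simp
        finally have "ennreal (w k) * (\<integral>\<^sup>+z. ennreal (infdist (\<theta> k z) B powr r) \<partial>\<nu>)
           \<le> ennreal (w k) * (ennreal (c powr r) * ennreal (b * (\<epsilon> / u k) powr (1 - s)))"
          by (rule mult_left_mono) simp
        also have "\<dots> = ennreal (b * (u k * (\<epsilon> / u k) powr (1 - s)))"
          using w_pos[OF k] c_pos ab by (simp add: ennreal_mult[symmetric] u_def mult_ac less_imp_le)
        \<comment> \<open>The weight \<open>u k\<close> against the exponent \<open>1 - s\<close>
          leaves \<open>u k powr s\<close>, again \<open>t k\<close>; hence the errors also add up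
          to the bound at \<epsilon>.\<close>
        also have "u k * (\<epsilon> / u k) powr (1 - s) = \<epsilon> powr (1 - s) * (u k powr 1 / u k powr (1 - s))"
          using \<epsilon> u_pos[OF k] by (simp add: powr_divide)
        also have "u k powr 1 / u k powr (1 - s) = t k"
          unfolding t_def by (simp only: powr_diff[symmetric]) simp
        finally show "ennreal (w k) * (\<integral>\<^sup>+z. ennreal (infdist (\<theta> k z) B powr r) \<partial>\<nu>)
            \<le> ennreal (b * \<epsilon> powr (1 - s) * t k)" by (simp add: mult.assoc)
      qed
      also have "\<dots> = ennreal (\<Sum>k\<in>I. b * \<epsilon> powr (1 - s) * t k)"
        using ab t_pos by (intro sum_ennreal mult_nonneg_nonneg) (auto intro: less_imp_le)
      also have "(\<Sum>k\<in>I. b * \<epsilon> powr (1 - s) * t k) = b * \<epsilon> powr (1 - s)"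
        by (simp add: sum_distrib_left[symmetric] t_sum)
      finally show ?thesis .
    qed
    ultimately show ?thesis unfolding Q_def by blast
  qed
  have "Q \<epsilon>" if "x ^ j \<le> \<epsilon>" "\<epsilon> \<le> 1 / m" for j \<epsilon>
    using that
  proof (induction j arbitrary: \<epsilon>)
    case (Suc j)
    show ?case
    proof (cases "1 \<le> \<epsilon>")
      case False
      have \<epsilon>: "0 < \<epsilon>" using Suc.prems x zero_less_power[of x "Suc j"] by linarith
      show ?thesis
      proof (rule step[OF \<epsilon>])
        fix k assume k: "k \<in> I"
        \<comment> \<open>Dividing by \<open>u k\<close> gains at least the factor
          \<open>1 / x\<close>, enough to return to level \<open>j\<close>; since \<epsilon> is
          below 1 and \<open>m \<le> u k\<close>, the new scale does not exceed
          \<open>1 / m\<close>.\<close>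
        have "x ^ j * u k \<le> x ^ j * x" using x k by (intro mult_left_mono) auto
        then have "x ^ j \<le> \<epsilon> / u k" using Suc.prems u_pos[OF k] by (simp add: field_simps)
        moreover have "\<epsilon> / u k \<le> 1 / m" using False \<epsilon> m k by (intro frac_le) auto
        ultimately show "Q (\<epsilon> / u k)" by (rule Suc.IH)
      qed
    qed (use base Suc.prems in auto)
  qed (use base in simp)
  moreover have "\<exists>j. x ^ j \<le> \<epsilon>" if "0 < \<epsilon>" for \<epsilon>
    using real_arch_pow_inv[OF that x(2)] less_imp_le by blast
  moreover have "1 \<le> 1 / m"
  proof -
    obtain i where "i \<in> I" using I0 by blast
    then have "m \<le> 1" using m(2) u_less_1[of i] by fastforce
    then show ?thesis using m(1) by simp
  qed
  ultimately have "Q \<epsilon>" if "0 < \<epsilon>" "\<epsilon> \<le> 1" for \<epsilon> using that by (meson order_trans)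
  then show ?thesis using ab unfolding Q_def by blast
qed

section \<open>Lower bound for the quantization error\<close>

lemma word_weight_t:
  assumes "\<sigma> \<in> words I L"
  shows "word_weight w \<sigma> * (c ^ L) powr r = word_weight t \<sigma> powr (1 / s)"
proof -
  have "set \<sigma> \<subseteq> I \<Longrightarrow> word_weight t \<sigma> \<ge> 0 \<and> word_weight w \<sigma> * (c ^ length \<sigma>) powr r = word_weight t \<sigma> powr (1 / s)"
  proof (induction \<sigma>)
    case (Cons k \<sigma>)
    then have k: "k \<in> I" by simp
    have "t k powr (1 / s) = u k" using u_pos[OF k] s_pos by (simp add: t_def powr_powr)
    then show ?case
      using Cons t_pos[OF k] c_pos by (simp add: powr_mult u_def mult_ac)
  qed simp
  with assms show ?thesis by (simp add: words_def)
qed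

text \<open>Of at least \<open>2 * M * n\<close> typical words, at most \<open>M * n\<close> have a
  cylinder near \<open>B\<close>. At least \<open>n\<close> remain whose copies of the support stay
  at distance \<open>c ^ L\<close> from \<open>B\<close>, and by \<open>word_weight_t\<close> each
  contributes at least \<open>exp (- L * (H + \<eta>) / s)\<close> to the error.\<close>

lemma quantization_lower:
  assumes \<eta>: "0 < \<eta>"
  shows "\<exists>M\<ge>1. \<exists>L0. \<forall>L\<ge>L0. \<forall>n B. finite B \<longrightarrow> B \<noteq> {} \<longrightarrow> card B \<le> n \<longrightarrow>
     4 * real M * real n \<le> exp (real L * (H - \<eta>)) \<longrightarrow>
     ennreal (real n * exp (- (real L * (H + \<eta>)) / s)) \<le> (\<integral>\<^sup>+z. ennreal (infdist z B powr r) \<partial>\<nu>)"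
proof -
  obtain R where R: "0 < R" "AE z in \<nu>. z \<in> cball 0 R" using bounded_support by blast
  obtain M :: nat where M: "1 \<le> M" and overlap: "\<And>L B. finite B \<Longrightarrow> B \<noteq> {} \<Longrightarrow>
     card {\<sigma>\<in>words I L. \<exists>z\<in>cball 0 R. infdist (act \<sigma> z) B < c ^ L} \<le> M * card B"
    using bounded_overlap[of R] by blast
  from typical_words[OF finite_I t_pos t_sum \<eta>]
  obtain L0 where L0: "\<And>L. L0 \<le> L \<Longrightarrow> \<exists>T\<subseteq>words I L. exp (real L * (H - \<eta>)) / 2 \<le> real (card T) \<and>
           (\<forall>\<sigma>\<in>T. exp (- (real L * (H + \<eta>))) \<le> word_weight t \<sigma>)"
    unfolding H_def by auto
  have "ennreal (real n * exp (- (real L * (H + \<eta>)) / s)) \<le> (\<integral>\<^sup>+z. ennreal (infdist z B powr r) \<partial>\<nu>)"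
    if L: "L0 \<le> L" and B: "finite B" "B \<noteq> {}" "card B \<le> n"
      and n: "4 * real M * real n \<le> exp (real L * (H - \<eta>))" for L n B
  proof -
    obtain T where T: "T \<subseteq> words I L" "exp (real L * (H - \<eta>)) / 2 \<le> real (card T)"
      "\<And>\<sigma>. \<sigma> \<in> T \<Longrightarrow> exp (- (real L * (H + \<eta>))) \<le> word_weight t \<sigma>"
      using L0[OF L] by blast
    define E where "E = {\<sigma>\<in>words I L. \<exists>z\<in>cball 0 R. infdist (act \<sigma> z) B < c ^ L}"
    have finW: "finite (words I L)" by (rule finite_words[OF finite_I])
    have "card E \<le> M * card B" unfolding E_def by (rule overlap[OF B(1,2)])
    also have "\<dots> \<le> M * n" using B by simp
    finally have "real (card E) \<le> real M * real n" by (metis of_nat_le_iff of_nat_mult)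
    moreover have "real (card T) \<le> real (card (T - E)) + real (card E)"
      using diff_card_le_card_Diff[of E T] finite_subset[OF _ finW, of E] by (simp add: E_def)
    ultimately have "real M * real n \<le> real (card (T - E))" using n T(2) by linarith
    moreover have "real n \<le> real M * real n" using M by (simp add: mult_le_cancel_right1)
    ultimately have card: "real n \<le> real (card (T - E))" by linarith
    define e where "e = exp (- (real L * (H + \<eta>)) / s)"
    have "ennreal (real n * e) \<le> ennreal (\<Sum>\<sigma>\<in>T - E. e)"
      using card by (intro ennreal_leI) (simp add: e_def mult_right_mono)
    also have "\<dots> = (\<Sum>\<sigma>\<in>T - E. ennreal e)" by (rule sum_ennreal[symmetric]) (simp add: e_def)
    also have "\<dots> \<le> (\<Sum>\<sigma>\<in>T - E. ennreal (word_weight w \<sigma>) * (\<integral>\<^sup>+z. ennreal (infdist (act \<sigma> z) B powr r) \<partial>\<nu>))"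
    proof (rule sum_mono)
      fix \<sigma> assume \<sigma>: "\<sigma> \<in> T - E"
      then have W: "\<sigma> \<in> words I L" using T by auto
      have far: "c ^ L \<le> infdist (act \<sigma> z) B" if "z \<in> cball 0 R" for z
        using \<sigma> W that by (force simp: E_def)
      have "e = exp (- (real L * (H + \<eta>))) powr (1 / s)"
        by (simp add: e_def powr_def)
      also have "\<dots> \<le> word_weight t \<sigma> powr (1 / s)"
        using T(3) \<sigma> s_pos by (intro powr_mono2) auto
      also have "\<dots> = word_weight w \<sigma> * (c ^ L) powr r" by (rule word_weight_t[OF W, symmetric])
      finally have "ennreal e \<le> ennreal (word_weight w \<sigma> * (c ^ L) powr r)" by (rule ennreal_leI)
      also have "\<dots> = ennreal (word_weight w \<sigma>) * (\<integral>\<^sup>+z. ennreal ((c ^ L) powr r) \<partial>\<nu>)"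
        using word_weight_pos[OF w_pos W] emeasure_space_1 by (simp add: ennreal_mult less_imp_le)
      also have "\<dots> \<le> ennreal (word_weight w \<sigma>) * (\<integral>\<^sup>+z. ennreal (infdist (act \<sigma> z) B powr r) \<partial>\<nu>)"
        using R(2) by (intro mult_left_mono nn_integral_mono_AE, eventually_elim)
          (auto intro!: ennreal_leI powr_mono2 far simp: c_pos less_imp_le r_pos)
      finally show "ennreal e \<le> ennreal (word_weight w \<sigma>) * (\<integral>\<^sup>+z. ennreal (infdist (act \<sigma> z) B powr r) \<partial>\<nu>)" .
    qed
    also have "\<dots> \<le> (\<Sum>\<sigma>\<in>words I L. ennreal (word_weight w \<sigma>) * (\<integral>\<^sup>+z. ennreal (infdist (act \<sigma> z) B powr r) \<partial>\<nu>))"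
      using T finW by (intro sum_mono2) auto
    also have "\<dots> = (\<integral>\<^sup>+z. ennreal (infdist z B powr r) \<partial>\<nu>)"
      by (rule nn_integral_words[symmetric]) (rule measurable_error)
    finally show ?thesis unfolding e_def .
  qed
  with M show ?thesis by blast
qed

section \<open>Logarithmic asymptotics of \<open>quant_V\<close>\<close>

lemma quant_V_le:
  assumes "finite B" "B \<noteq> {}" "card B \<le> n" "0 \<le> x"
    and "(\<integral>\<^sup>+z. ennreal (infdist z B powr r) \<partial>\<nu>) \<le> ennreal x"
  shows "quant_V \<nu> r n \<le> x"
proof -
  have "(INF B \<in> {B. finite B \<and> B \<noteq> {} \<and> card B \<le> n}. \<integral>\<^sup>+ z. ennreal (infdist z B powr r) \<partial>\<nu>) \<le> ennreal x"
    using assms by (intro INF_lower2[of B]) auto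
  then show ?thesis unfolding quant_V_def by (rule enn2real_leI[OF assms(4)])
qed

lemma quant_V_ge:
  assumes "1 \<le> n"
    and "\<And>B. finite B \<Longrightarrow> B \<noteq> {} \<Longrightarrow> card B \<le> n \<Longrightarrow> ennreal x \<le> (\<integral>\<^sup>+z. ennreal (infdist z B powr r) \<partial>\<nu>)"
  shows "x \<le> quant_V \<nu> r n"
proof -
  let ?V = "INF B \<in> {B. finite B \<and> B \<noteq> {} \<and> card B \<le> n}. \<integral>\<^sup>+ z. ennreal (infdist z B powr r) \<partial>\<nu>"
  obtain R where R: "0 < R" "AE z in \<nu>. z \<in> cball 0 R" using bounded_support by blast
  \<comment> \<open>The single point 0 shows that the infimum is finite; \<open>enn2real\<close>
    would turn an infinite value into 0 and lose the lower bound.\<close>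
  have "?V \<le> (\<integral>\<^sup>+ z. ennreal (infdist z {0} powr r) \<partial>\<nu>)"
    using assms(1) by (intro INF_lower) auto
  also have "\<dots> \<le> (\<integral>\<^sup>+z. ennreal (R powr r) \<partial>\<nu>)"
    using R(2) by (intro nn_integral_mono_AE, eventually_elim)
      (auto simp: r_pos less_imp_le intro!: ennreal_leI powr_mono2)
  also have "\<dots> < top" using emeasure_space_1 by simp
  finally have "?V < top" .
  moreover have "ennreal x \<le> ?V" using assms(2) by (intro INF_greatest) auto
  ultimately have "ennreal x \<le> ennreal (enn2real ?V)" by simp
  then show ?thesis
    unfolding quant_V_def using enn2real_nonneg[of ?V] by (auto simp: ennreal_le_iff2)
qed

end

text \<open>Additive constants in the estimates of \<open>ln (quant_V \<nu> r n)\<close> disappear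
  after division by \<open>ln n\<close>.\<close>

lemma tendsto_add_div_ln:
  "(\<lambda>n. l + K * inverse (ln (real n))) \<longlonglongrightarrow> (l::real)"
proof -
  have "filterlim (\<lambda>n. ln (real n)) at_top sequentially"
    by (rule filterlim_compose[OF ln_at_top filterlim_real_sequentially])
  then have "(\<lambda>n. l + K * inverse (ln (real n))) \<longlonglongrightarrow> l + K * 0"
    by (intro tendsto_intros tendsto_inverse_0_at_top)
  then show ?thesis by simp
qed

context self_similar_exponent
begin

text \<open>For given \<open>n\<close>, the level \<open>L\<close> is the least one satisfying
  \<open>4 * M * n \<le> exp (L * (H - \<eta>))\<close>, which gives the best bound from
  \<open>quantization_lower\<close>. It exceeds \<open>ln n / (H - \<eta>)\<close> by a bounded
  amount only, and is at least \<open>L0\<close> once \<open>n\<close> is large.\<close>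

lemma ln_quant_V_lower:
  assumes \<eta>: "0 < \<eta>" "\<eta> < H"
  shows "\<exists>K. \<forall>\<^sub>F n in sequentially. 0 < quant_V \<nu> r n \<and>
     ln (real n) - (ln (real n) / (H - \<eta>) + K) * ((H + \<eta>) / s) \<le> ln (quant_V \<nu> r n)"
proof -
  from quantization_lower[OF \<eta>(1)]
  obtain M L0 where M: "1 \<le> M" and lower: "\<forall>L\<ge>L0. \<forall>n B. finite B \<longrightarrow> B \<noteq> {} \<longrightarrow> card B \<le> n \<longrightarrow>
     4 * real M * real n \<le> exp (real L * (H - \<eta>)) \<longrightarrow>
     ennreal (real n * exp (- (real L * (H + \<eta>)) / s)) \<le> (\<integral>\<^sup>+z. ennreal (infdist z B powr r) \<partial>\<nu>)"
    by (elim exE conjE)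
  \<comment> \<open>The logarithm accounts for the factor \<open>4 * M\<close> in front of
    \<open>n\<close>, and the 1 for rounding \<open>L\<close> up.\<close>
  define K where "K = ln (4 * real M) / (H - \<eta>) + 1"
  have d: "0 < H - \<eta>" using \<eta> by simp
  have "filterlim (\<lambda>n. ln (real n)) at_top sequentially"
    by (rule filterlim_compose[OF ln_at_top filterlim_real_sequentially])
  then have "\<forall>\<^sub>F n in sequentially. real L0 * (H - \<eta>) \<le> ln (real n)"
    by (simp add: filterlim_at_top)
  moreover have "\<forall>\<^sub>F n::nat in sequentially. 1 \<le> n" by (rule eventually_ge_at_top)
  ultimately have "\<forall>\<^sub>F n in sequentially. 0 < quant_V \<nu> r n \<and>
     ln (real n) - (ln (real n) / (H - \<eta>) + K) * ((H + \<eta>) / s) \<le> ln (quant_V \<nu> r n)"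
  proof eventually_elim
    case (elim n)
    define y where "y = ln (4 * real M * real n)"
    have y: "y = ln (4 * real M) + ln (real n)"
      using M elim by (simp add: y_def ln_mult_pos)
    have "0 \<le> ln (4 * real M)" using M by simp
    then have "real L0 * (H - \<eta>) \<le> y" using elim y by simp
    then have L0: "real L0 \<le> y / (H - \<eta>)" using d by (simp add: field_simps)
    define L where "L = nat \<lceil>y / (H - \<eta>)\<rceil>"
    have "0 \<le> y / (H - \<eta>)" using L0 by linarith
    then have L: "y / (H - \<eta>) \<le> real L" "real L \<le> y / (H - \<eta>) + 1"
      unfolding L_def by linarith+
    have "L0 \<le> L" using L0 L by linarith
    have "y \<le> real L * (H - \<eta>)" using L d by (simp add: field_simps)
    moreover have "4 * real M * real n = exp y" using M elim by (simp add: y_def)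
    ultimately have "4 * real M * real n \<le> exp (real L * (H - \<eta>))" by simp
    then have V: "real n * exp (- (real L * (H + \<eta>)) / s) \<le> quant_V \<nu> r n"
      using elim \<open>L0 \<le> L\<close> lower by (intro quant_V_ge) simp_all
    have "0 < real n * exp (- (real L * (H + \<eta>)) / s)" using elim by simp
    with V have pos: "0 < quant_V \<nu> r n" by linarith
    have "real L * ((H + \<eta>) / s) \<le> (ln (real n) / (H - \<eta>) + K) * ((H + \<eta>) / s)"
      using L \<eta> s_pos y by (intro mult_right_mono) (auto simp: K_def add_divide_distrib)
    moreover have "ln (real n) - real L * ((H + \<eta>) / s) = ln (real n * exp (- (real L * (H + \<eta>)) / s))"
      using elim by (simp add: ln_mult_pos)
    moreover have "\<dots> \<le> ln (quant_V \<nu> r n)" using V elim pos by (subst ln_le_cancel_iff) auto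
    ultimately show ?case using pos by linarith
  qed
  then show ?thesis by blast
qed

text \<open>Positivity is a premise because it comes from the lower bound, through
  \<open>quant_V_pos\<close>; it lets \<open>ln\<close> preserve the estimate.\<close>

lemma ln_quant_V_upper:
  "\<exists>K. \<forall>\<^sub>F n in sequentially. 0 < quant_V \<nu> r n \<longrightarrow>
     ln (quant_V \<nu> r n) \<le> K - (1 - s) / s * ln (real n)"
proof -
  obtain a b where ab: "0 < a" "0 < b" and upper: "\<And>\<epsilon>. 0 < \<epsilon> \<Longrightarrow> \<epsilon> \<le> 1 \<Longrightarrow>
     \<exists>B. finite B \<and> B \<noteq> {} \<and> real (card B) \<le> a * \<epsilon> powr - s \<and>
      (\<integral>\<^sup>+z. ennreal (infdist z B powr r) \<partial>\<nu>) \<le> ennreal (b * \<epsilon> powr (1 - s))"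
    using quantization_upper by blast
  have "\<forall>\<^sub>F n::nat in sequentially. max 1 a \<le> real n"
    by (rule eventually_compose_filterlim[OF eventually_ge_at_top filterlim_real_sequentially])
  then have "\<forall>\<^sub>F n in sequentially. 0 < quant_V \<nu> r n \<longrightarrow>
     ln (quant_V \<nu> r n) \<le> (ln b + (1 - s) / s * ln a) - (1 - s) / s * ln (real n)"
  proof eventually_elim
    case (elim n)
    \<comment> \<open>Chosen so that \<open>a * \<epsilon> powr - s\<close> equals \<open>n\<close>;
      the condition \<open>a \<le> n\<close> keeps \<epsilon> at most 1.\<close>
    define \<epsilon> where "\<epsilon> = (a / real n) powr (1 / s)"
    have n: "0 < real n" "a \<le> real n" using elim by auto
    then have \<epsilon>: "0 < \<epsilon>" "\<epsilon> \<le> 1"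
      using ab s_pos powr_mono2[of "1 / s" "a / real n" 1] by (auto simp: \<epsilon>_def)
    have "a * \<epsilon> powr - s = real n"
      using n ab s_pos by (simp add: \<epsilon>_def powr_powr powr_minus)
    then obtain B where "finite B" "B \<noteq> {}" "card B \<le> n"
      "(\<integral>\<^sup>+z. ennreal (infdist z B powr r) \<partial>\<nu>) \<le> ennreal (b * \<epsilon> powr (1 - s))"
      using upper[OF \<epsilon>] by auto
    then have V: "quant_V \<nu> r n \<le> b * \<epsilon> powr (1 - s)"
      using ab by (intro quant_V_le) auto
    show ?case
    proof
      assume pos: "0 < quant_V \<nu> r n"
      with V have "ln (quant_V \<nu> r n) \<le> ln (b * \<epsilon> powr (1 - s))"
        using ab \<epsilon> by (subst ln_le_cancel_iff) auto
      also have "\<dots> = ln b + (1 - s) / s * (ln a - ln (real n))"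
        using ab \<epsilon> n by (simp add: ln_mult_pos ln_powr \<epsilon>_def ln_div)
      finally show "ln (quant_V \<nu> r n) \<le> (ln b + (1 - s) / s * ln a) - (1 - s) / s * ln (real n)"
        by (simp only: right_diff_distrib)
    qed
  qed
  then show ?thesis by blast
qed

lemma quant_V_pos: "\<forall>\<^sub>F n in sequentially. 0 < quant_V \<nu> r n"
proof -
  obtain K where "\<forall>\<^sub>F n in sequentially. 0 < quant_V \<nu> r n \<and>
     ln (real n) - (ln (real n) / (H - H / 2) + K) * ((H + H / 2) / s) \<le> ln (quant_V \<nu> r n)"
    using ln_quant_V_lower[of "H / 2"] H_pos by auto
  then show ?thesis by (rule eventually_mono) simp
qed

text \<open>The upper bound on \<open>quant_V\<close> has the exact exponent. The lower bound has it
  only up to \<eta>, so for each \<open>x\<close> above the limit a small \<eta> is fixed before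
  \<open>n\<close> grows.\<close>

lemma quant_V_exponent:
  "(\<lambda>n. - ln (quant_V \<nu> r n) / ln (real n)) \<longlonglongrightarrow> (1 - s) / s"
proof (rule order_tendstoI)
  have large: "\<forall>\<^sub>F n::nat in sequentially. 2 \<le> n" by (rule eventually_ge_at_top)
  fix x assume x: "x < (1 - s) / s"
  obtain K where K: "\<forall>\<^sub>F n in sequentially. 0 < quant_V \<nu> r n \<longrightarrow>
     ln (quant_V \<nu> r n) \<le> K - (1 - s) / s * ln (real n)"
    using ln_quant_V_upper by blast
  have "\<forall>\<^sub>F n in sequentially. x < (1 - s) / s + (- K) * inverse (ln (real n))"
    by (rule order_tendstoD(1)[OF tendsto_add_div_ln x])
  with large quant_V_pos K show "\<forall>\<^sub>F n in sequentially. x < - ln (quant_V \<nu> r n) / ln (real n)"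
  proof eventually_elim
    case (elim n)
    then have l: "0 < ln (real n)" by simp
    note \<open>x < (1 - s) / s + (- K) * inverse (ln (real n))\<close>
    also have "(1 - s) / s + (- K) * inverse (ln (real n)) = ((1 - s) / s * ln (real n) - K) / ln (real n)"
    proof -
      have "A + (- K) * inverse l = (A * l - K) / l" if "0 < l" for A l :: real
        using that by (simp add: field_simps)
      then show ?thesis using l by blast
    qed
    also have "\<dots> \<le> - ln (quant_V \<nu> r n) / ln (real n)"
      using elim l by (intro divide_right_mono) auto
    finally show ?case .
  qed
next
  have large: "\<forall>\<^sub>F n::nat in sequentially. 2 \<le> n" by (rule eventually_ge_at_top)
  fix x assume x: "(1 - s) / s < x"
  \<comment> \<open>The exponent in the lower bound equals \<open>1 / s - 1\<close> at \<eta> = 0;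
    by continuity some positive \<eta> below \<open>H\<close> keeps it under
    \<open>x\<close>.\<close>
  have "((\<lambda>\<eta>. 1 / (H - \<eta>) * ((H + \<eta>) / s) - 1) \<longlongrightarrow> 1 / (H - 0) * ((H + 0) / s) - 1) (at_right 0)"
    using H_pos s_pos by (intro tendsto_intros) auto
  also have "1 / (H - 0) * ((H + 0) / s) - 1 = (1 - s) / s"
    using H_pos s_pos by (simp add: field_simps)
  finally have "\<forall>\<^sub>F \<eta> in at_right 0. 1 / (H - \<eta>) * ((H + \<eta>) / s) - 1 < x"
    using x by (rule order_tendstoD(2))
  moreover have "\<forall>\<^sub>F \<eta> in at_right 0. 0 < \<eta> \<and> \<eta> < H"
    using eventually_at_right_real[OF H_pos] by simp
  ultimately have "\<forall>\<^sub>F \<eta> in at_right 0. 1 / (H - \<eta>) * ((H + \<eta>) / s) - 1 < x \<and> 0 < \<eta> \<and> \<eta> < H"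
    by eventually_elim simp
  then obtain \<eta> where \<eta>: "1 / (H - \<eta>) * ((H + \<eta>) / s) - 1 < x" "0 < \<eta>" "\<eta> < H"
    using eventually_happens'[OF trivial_limit_at_right_real] by blast
  obtain K where K: "\<forall>\<^sub>F n in sequentially. 0 < quant_V \<nu> r n \<and>
     ln (real n) - (ln (real n) / (H - \<eta>) + K) * ((H + \<eta>) / s) \<le> ln (quant_V \<nu> r n)"
    using ln_quant_V_lower[OF \<eta>(2,3)] by blast
  have "\<forall>\<^sub>F n in sequentially. (1 / (H - \<eta>) * ((H + \<eta>) / s) - 1)
      + (K * ((H + \<eta>) / s)) * inverse (ln (real n)) < x"
    by (rule order_tendstoD(2)[OF tendsto_add_div_ln \<eta>(1)])
  with large K show "\<forall>\<^sub>F n in sequentially. - ln (quant_V \<nu> r n) / ln (real n) < x"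
  proof eventually_elim
    case (elim n)
    define A where "A = (H + \<eta>) / s"
    from elim have l: "0 < ln (real n)" by simp
    have "- ln (quant_V \<nu> r n) / ln (real n) \<le> ((ln (real n) / (H - \<eta>) + K) * A - ln (real n)) / ln (real n)"
      using elim l by (intro divide_right_mono) (auto simp: A_def)
    also have "\<dots> = (1 / (H - \<eta>) * A - 1) + (K * A) * inverse (ln (real n))"
    proof -
      have "((l / d + K) * A - l) / l = (1 / d * A - 1) + (K * A) * inverse l"
        if "0 < l" "0 < d" for l d :: real using that by (simp add: field_simps)
      then show ?thesis using l \<eta> by simp
    qed
    also have "\<dots> < x" using elim by (simp add: A_def)
    finally show ?case .
  qed
qed

text \<open>As \<open>quant_e\<close> is \<open>quant_V\<close> to the power \<open>1 / r\<close>,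
  the quotient is eventually \<open>r\<close> times the reciprocal of the one in
  \<open>quant_V_exponent\<close>, whose limit is nonzero because \<open>s < 1\<close>.\<close>

theorem quantization_dimension_eq: "quantization_dimension \<nu> r = r * s / (1 - s)"
  unfolding quantization_dimension_def
proof (rule limI)
  have "(\<lambda>n. r * inverse (- ln (quant_V \<nu> r n) / ln (real n))) \<longlonglongrightarrow> r * inverse ((1 - s) / s)"
    using s_pos s_less by (intro tendsto_intros quant_V_exponent) auto
  moreover have "\<forall>\<^sub>F n in sequentially. r * inverse (- ln (quant_V \<nu> r n) / ln (real n))
      = ln (real n) / - ln (quant_e \<nu> r n)"
    using quant_V_pos
  proof eventually_elim
    case (elim n)
    then have "ln (quant_e \<nu> r n) = ln (quant_V \<nu> r n) / r"
      unfolding quant_e_def by (simp add: ln_powr)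
    then show ?case using r_pos by simp
  qed
  ultimately have "(\<lambda>n. ln (real n) / - ln (quant_e \<nu> r n)) \<longlonglongrightarrow> r * inverse ((1 - s) / s)"
    by (rule Lim_transform_eventually)
  then show "(\<lambda>n. ln (real n) / - ln (quant_e \<nu> r n)) \<longlonglongrightarrow> r * s / (1 - s)" by simp
qed

end

text \<open>Intermediate value theorem: \<phi> equals \<open>card I\<close> at 0 and
  \<open>c powr r\<close> at 1, values strictly on either side of 1, so the solution is
  interior.\<close>

lemma (in self_similar_measure) exponent_exists:
  "\<exists>s. self_similar_exponent I \<theta> w c r \<nu> U s"
proof -
  define \<phi> where "\<phi> s = (\<Sum>i\<in>I. (w i * c powr r) powr s)" for s
  have b: "0 < w i * c powr r" if "i \<in> I" for i using w_pos[OF that] c_pos by simp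
  have w0: "w i \<noteq> 0" if "i \<in> I" for i using w_pos[OF that] by simp
  have c1: "c powr r < 1" using powr_less_mono2[OF r_pos _ c_less] c_pos by simp
  have "\<phi> 0 = (\<Sum>i\<in>I. 1)"
    unfolding \<phi>_def using c_pos by (intro sum.cong) (auto simp: w0)
  then have 0: "1 < \<phi> 0" using card_I by simp
  have "\<phi> 1 = (\<Sum>i\<in>I. w i * c powr r)"
    unfolding \<phi>_def using b by (intro sum.cong) (auto simp: less_imp_le)
  then have 1: "\<phi> 1 < 1" using c1 by (simp add: sum_distrib_right[symmetric] w_sum)
  have "continuous_on {0..1} \<phi>"
    unfolding \<phi>_def using w0 c_pos by (intro continuous_intros) auto
  then obtain s where s: "0 \<le> s" "s \<le> 1" "\<phi> s = 1"
    using IVT2'[of \<phi> 1 1 0] 0 1 by auto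
  with 0 1 have "0 < s" "s < 1" by (auto simp: order_less_le)
  with s show ?thesis
    unfolding \<phi>_def
    by (intro exI[of _ s] self_similar_exponent.intro self_similar_measure_axioms
        self_similar_exponent_axioms.intro) auto
qed

section \<open>Comparison with the product system\<close>

text \<open>If \<open>s' \<le> s\<close>, the double sum at \<open>s\<close> is at most the one at
  \<open>s'\<close>, which is 1, because all bases are at most 1. The factorization makes it exceed
  1 at \<open>s\<close>, a contradiction.\<close>

lemma product_exponent_greater:
  fixes p :: "'i \<Rightarrow> real" and q :: "'j \<Rightarrow> real"
  assumes p: "\<And>i. i \<in> I \<Longrightarrow> 0 < p i" "\<And>i. i \<in> I \<Longrightarrow> p i \<le> 1"
    and q: "finite J" "J \<noteq> {}" "\<And>j. j \<in> J \<Longrightarrow> 0 < q j" "\<And>j. j \<in> J \<Longrightarrow> q j < 1" "(\<Sum>j\<in>J. q j) = 1"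
    and C: "0 < C" "C \<le> 1" and s: "s < 1"
    and eq: "(\<Sum>i\<in>I. (p i * C) powr s) = 1" "(\<Sum>i\<in>I. \<Sum>j\<in>J. (p i * q j * C) powr s') = 1"
  shows "s < s'"
proof (rule ccontr)
  assume "\<not> s < s'"
  have "1 = (\<Sum>j\<in>J. q j)" by (simp add: q)
  also have "\<dots> < (\<Sum>j\<in>J. q j powr s)"
  proof (rule sum_strict_mono[OF q(1,2)])
    fix j assume j: "j \<in> J"
    have "q j powr 1 < q j powr s" using q(3,4)[OF j] s by (intro powr_less_mono') auto
    then show "q j < q j powr s" using q(3)[OF j] by simp
  qed
  \<comment> \<open>A factor equal to 1 is inserted; the constant \<open>C\<close> of the product
    system goes entirely with the \<open>p i\<close>.\<close>
  also have "\<dots> = (\<Sum>i\<in>I. (p i * C) powr s) * (\<Sum>j\<in>J. q j powr s)" by (simp add: eq)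
  also have "\<dots> = (\<Sum>i\<in>I. \<Sum>j\<in>J. (p i * q j * C) powr s)"
    unfolding sum_product using p q C
    by (intro sum.cong refl) (simp add: powr_mult less_imp_le mult_ac)
  also have "\<dots> \<le> (\<Sum>i\<in>I. \<Sum>j\<in>J. (p i * q j * C) powr s')"
  proof (intro sum_mono)
    fix i j assume ij: "i \<in> I" "j \<in> J"
    have "p i * q j \<le> 1 * 1" using p q ij by (intro mult_mono) (auto simp: less_imp_le)
    then have "p i * q j * C \<le> 1 * 1"
      using p q C ij by (intro mult_mono) (auto simp: less_imp_le)
    then show "(p i * q j * C) powr s \<le> (p i * q j * C) powr s'"
      using p q C ij \<open>\<not> s < s'\<close> by (intro powr_mono') (auto simp: less_imp_le)
  qed
  also have "\<dots> = 1" by (rule eq)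
  finally show False by simp
qed

theorem mainTheorem12:
  fixes f g :: "nat \<Rightarrow> 'a::euclidean_space \<Rightarrow> 'a"
    and p q :: "nat \<Rightarrow> real"
    and c r :: real and N :: nat
    and \<mu>F \<mu>G :: "'a measure" and \<mu>FG :: "('a \<times> 'a) measure"
  assumes N: "N \<ge> 2"
    and c: "0 < c" "c < 1"
    and f_sim: "\<And>i x x'. i < N \<Longrightarrow> norm (f i x - f i x') = c * norm (x - x')"
    and g_sim: "\<And>i y y'. i < N \<Longrightarrow> norm (g i y - g i y') = c * norm (y - y')"
    and p_pos: "\<And>i. i < N \<Longrightarrow> p i > 0" and p_sum: "(\<Sum>i<N. p i) = 1"
    and q_pos: "\<And>i. i < N \<Longrightarrow> q i > 0" and q_sum: "(\<Sum>i<N. q i) = 1"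
    and inv_F: "invariant_measure {..<N} f p \<mu>F"
    and inv_G: "invariant_measure {..<N} g q \<mu>G"
    and inv_FG: "invariant_measure ({..<N} \<times> {..<N})
                   (\<lambda>(i, j) (x, y). (f i x, g j y)) (\<lambda>(i, j). p i * q j) \<mu>FG"
    and osc_F: "osc N f" and osc_G: "osc N g"
    and r: "0 < r"
  shows "quantization_dimension \<mu>FG r >
           max (quantization_dimension \<mu>F r) (quantization_dimension \<mu>G r)"
proof -
  obtain U where U: "open U" "U \<noteq> {}" "\<And>i. i < N \<Longrightarrow> f i ` U \<subseteq> U"
     "\<And>i j. i < N \<Longrightarrow> j < N \<Longrightarrow> i \<noteq> j \<Longrightarrow> f i ` U \<inter> f j ` U = {}"
  proof -
    from osc_F obtain U where "open U \<and> U \<noteq> {} \<and> (\<forall>i<N. f i ` U \<subseteq> U) \<and>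
      (\<forall>i<N. \<forall>j<N. i \<noteq> j \<longrightarrow> f i ` U \<inter> f j ` U = {})"
      unfolding osc_def ..
    then show thesis by (intro that[of U]) simp_all
  qed
  obtain V where V: "open V" "V \<noteq> {}" "\<And>i. i < N \<Longrightarrow> g i ` V \<subseteq> V"
     "\<And>i j. i < N \<Longrightarrow> j < N \<Longrightarrow> i \<noteq> j \<Longrightarrow> g i ` V \<inter> g j ` V = {}"
  proof -
    from osc_G obtain V where "open V \<and> V \<noteq> {} \<and> (\<forall>i<N. g i ` V \<subseteq> V) \<and>
      (\<forall>i<N. \<forall>j<N. i \<noteq> j \<longrightarrow> g i ` V \<inter> g j ` V = {})"
      unfolding osc_def ..
    then show thesis by (intro that[of V]) simp_all
  qed
  have F: "self_similar_measure {..<N} f p c r \<mu>F U"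
    using N c f_sim p_pos p_sum inv_F r U by unfold_locales (auto simp: dist_norm)
  have G: "self_similar_measure {..<N} g q c r \<mu>G V"
    using N c g_sim q_pos q_sum inv_G r V by unfold_locales (auto simp: dist_norm)
  let ?\<psi> = "\<lambda>(i, j) (x, y). (f i x, g j y)"
  \<comment> \<open>The pairs of indices form one more system with ratio \<open>c\<close>, and the
    product of the two open sets witnesses its open set condition.\<close>
  have FG: "self_similar_measure ({..<N} \<times> {..<N}) ?\<psi> (\<lambda>(i, j). p i * q j) c r \<mu>FG (U \<times> V)"
  proof
    show "2 \<le> card ({..<N} \<times> {..<N})"
      using mult_le_mono[of 2 N 1 N] N by simp
    show "dist (?\<psi> ij x) (?\<psi> ij y) = c * dist x y" if "ij \<in> {..<N} \<times> {..<N}" for ij x y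
    proof -
      \<comment> \<open>The norm on the product is Euclidean, so both squared coordinates pick up
        the same factor and the ratio stays \<open>c\<close>.\<close>
      have "(c * A)\<^sup>2 + (c * B)\<^sup>2 = c\<^sup>2 * (A\<^sup>2 + B\<^sup>2)" for A B
        by (simp add: power_mult_distrib distrib_left)
      with that f_sim g_sim c show ?thesis
        by (auto simp: dist_prod_def dist_norm real_sqrt_mult split: prod.splits)
    qed
    show "(\<Sum>ij\<in>{..<N} \<times> {..<N}. case ij of (i, j) \<Rightarrow> p i * q j) = 1"
      by (simp add: sum.cartesian_product[symmetric] sum_product[symmetric] p_sum q_sum)
    show "?\<psi> ij ` (U \<times> V) \<subseteq> U \<times> V" if "ij \<in> {..<N} \<times> {..<N}" for ij
      using that U(3) V(3) by (auto simp: image_subset_iff)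
    show "?\<psi> ij ` (U \<times> V) \<inter> ?\<psi> kl ` (U \<times> V) = {}"
      if "ij \<in> {..<N} \<times> {..<N}" "kl \<in> {..<N} \<times> {..<N}" "ij \<noteq> kl" for ij kl
    proof -
      obtain i j k l where eq: "ij = (i, j)" "kl = (k, l)" by force
      have sub: "?\<psi> ij ` (U \<times> V) \<subseteq> f i ` U \<times> g j ` V" "?\<psi> kl ` (U \<times> V) \<subseteq> f k ` U \<times> g l ` V"
        by (auto simp: eq)
      \<comment> \<open>Distinct pairs differ in some coordinate, and disjointness in that
        coordinate separates the products.\<close>
      have "f i ` U \<inter> f k ` U = {} \<or> g j ` V \<inter> g l ` V = {}"
        using that U(4)[of i k] V(4)[of j l] by (auto simp: eq)
      then have "(f i ` U \<inter> f k ` U) \<times> (g j ` V \<inter> g l ` V) = {}"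
        by (simp only: Times_empty)
      then show ?thesis
        using Int_mono[OF sub] by (simp only: Times_Int_Times subset_empty)
    qed
  qed (use c r inv_FG U(1,2) V(1,2) p_pos q_pos in \<open>auto intro: open_Times\<close>)
  obtain sF where sF: "self_similar_exponent {..<N} f p c r \<mu>F U sF"
    using self_similar_measure.exponent_exists[OF F] by blast
  obtain sG where sG: "self_similar_exponent {..<N} g q c r \<mu>G V sG"
    using self_similar_measure.exponent_exists[OF G] by blast
  obtain s where s: "self_similar_exponent ({..<N} \<times> {..<N}) ?\<psi> (\<lambda>(i, j). p i * q j) c r \<mu>FG (U \<times> V) s"
    using self_similar_measure.exponent_exists[OF FG] by blast
  interpret F: self_similar_exponent "{..<N}" f p c r \<mu>F U sF by (rule sF)
  interpret G: self_similar_exponent "{..<N}" g q c r \<mu>G V sG by (rule sG)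
  interpret FG: self_similar_exponent "{..<N} \<times> {..<N}" ?\<psi> "\<lambda>(i, j). p i * q j" c r \<mu>FG "U \<times> V" s by (rule s)
  \<comment> \<open>As \<open>N \<ge> 2\<close>, some other index carries positive weight, so no
    weight reaches 1.\<close>
  have less_1: "w i < 1" if "i < N" and "\<And>i. i < N \<Longrightarrow> 0 < w i" "(\<Sum>i<N. w i) = 1" for w :: "nat \<Rightarrow> real" and i
  proof -
    define j where "j = (if i = 0 then 1 else 0 :: nat)"
    have "j < N" "j \<noteq> i" using N by (auto simp: j_def)
    then have "(\<Sum>k\<in>{i, j}. w k) \<le> (\<Sum>k<N. w k)"
      using that by (intro sum_mono2) (auto simp: less_imp_le)
    then show ?thesis using \<open>j \<noteq> i\<close> that(2)[OF \<open>j < N\<close>] that(3) by simp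
  qed
  have C: "0 < c powr r" "c powr r \<le> 1"
    using c r powr_mono2[of r c 1] by auto
  have eq: "(\<Sum>i<N. \<Sum>j<N. (p i * q j * c powr r) powr s) = 1"
    using FG.s_sum by (simp add: sum.cartesian_product case_prod_unfold)
  \<comment> \<open>Exchanging the sums gives \<open>q\<close> the role of \<open>p\<close>, which
    is the form needed for the comparison with \<open>sG\<close>.\<close>
  also have "(\<Sum>i<N. \<Sum>j<N. (p i * q j * c powr r) powr s) = (\<Sum>j<N. \<Sum>i<N. (q j * p i * c powr r) powr s)"
    by (subst sum.swap) (simp add: mult.commute)
  finally have eq': "(\<Sum>j<N. \<Sum>i<N. (q j * p i * c powr r) powr s) = 1" .
  have "sF < s"
    by (rule product_exponent_greater[OF _ _ _ _ _ _ q_sum C F.s_less F.s_sum eq])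
      (use N p_pos q_pos p_sum q_sum less_1 in \<open>auto simp: less_imp_le lessThan_empty_iff\<close>)
  moreover have "sG < s"
    by (rule product_exponent_greater[OF _ _ _ _ _ _ p_sum C G.s_less G.s_sum eq'])
      (use N p_pos q_pos p_sum q_sum less_1 in \<open>auto simp: less_imp_le lessThan_empty_iff\<close>)
  \<comment> \<open>The dimension is a strictly increasing function of the exponent on (0,1), so the
    comparison of exponents carries over.\<close>
  moreover have "r * x / (1 - x) < r * s / (1 - s)" if "0 < x" "x < s" for x
    using that r FG.s_less by (intro frac_less) auto
  ultimately show ?thesis
    using F.s_pos G.s_pos
    by (simp add: F.quantization_dimension_eq G.quantization_dimension_eq FG.quantization_dimension_eq)
qed

end
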